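(* For $\alpha\in\mathbb{R}$ and $x>0$ let $\operatorname{Ki}_{\alpha}(x)=\int_0^{\infty}e^{-x\cosh t}(\cosh t)^{-\alpha}\,dt$. The following assertions are true. (a) The function $x\mapsto \operatorname{Ki}_{\alpha}(x)$ is completely monotonic on $(0,\infty)$ for all $\alpha\in\mathbb{R}$. (b) The function $\alpha\mapsto \operatorname{Ki}_{\alpha}(x)$ is completely monotonic on $\mathbb{R}$ for all $x>0$. (c) The function $\alpha\mapsto \operatorname{Ki}_{\alpha}(x)$ is log-convex on $\mathbb{R}$ for all $x>0$. (d) The function $x\mapsto \operatorname{Ki}_{\alpha}(x)$ is log-convex on $(0,\infty)$ for all $\alpha\in\mathbb{R}$. (e) The function $x\mapsto \operatorname{Ki}_{\alpha}(x)$ is geometrically concave on $(0,\infty)$ for all $\alpha\in\{-1,0,1,\dots\}$. Consequently, for all $\alpha\in\{-1,0,1,\dots\}$ and $x,y>0$, $$\operatorname{Ki}_{\alpha}(\sqrt{xy})\geq\sqrt{\operatorname{Ki}_{\alpha}(x)\operatorname{Ki}_{\alpha}(y)}\geq\operatorname{Ki}_{\alpha}\left(\frac{x+y}{2}\right),$$ $$1\leq \frac{\operatorname{Ki}_{\alpha}(x)\operatorname{Ki}_{\alpha-2}(x)}{\left[\operatorname{Ki}_{\alpha-1}(x)\right]^2}\leq 1+\frac{\operatorname{Ki}_{\alpha}(x)}{x\operatorname{Ki}_{\alpha-1}(x)}.$$ Moreover, the right-hand inequality of the first chain and the left-hand inequality of the second chain are valid for all real $\alpha$. (f) The inequality $$\operatorname{Ki}_{-\beta}(x)\operatorname{Ki}_{\alpha+\beta}(x)\leq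 \operatorname{Ki}_0(x)\operatorname{Ki}_{\alpha}(x)$$ is valid for all $x>0$ and all real $\alpha,\beta$ with $\alpha+\beta\leq0\leq\beta$ or $\alpha+\beta\geq0\geq\beta$. If $\beta\geq0$ and $\alpha+\beta\geq0$, or $\beta\leq0$ and $\alpha+\beta\leq0$, then this inequality is reversed. In particular, for all $\alpha\geq2$ and $x>0$, $$\frac{\operatorname{Ki}_{\alpha}''(x)}{\operatorname{Ki}_{\alpha}'(x)}=-\frac{\operatorname{Ki}_{\alpha-2}(x)}{\operatorname{Ki}_{\alpha-1}(x)}\geq-\frac{\operatorname{Ki}_{0}(x)}{\operatorname{Ki}_{1}(x)}=\frac{\operatorname{Ki}_{2}''(x)}{\operatorname{Ki}_{2}'(x)},$$ where primes denote derivatives in $x$; that is, $x\mapsto -\operatorname{Ki}_{\alpha}(x)$ is convex with respect to $x\mapsto -\operatorname{Ki}_{2}(x)$ on $(0,\infty)$ for $\alpha\geq2$. (g) If $\alpha+\beta\geq0$, $\beta\leq0$ and $x>0$, then $$\left|\operatorname{Ki}_0(x)\operatorname{Ki}_{\alpha}(x)-\operatorname{Ki}_{-\beta}(x)\operatorname{Ki}_{\alpha+\beta}(x)\right|\leq\frac{\left[\operatorname{Ki}_{0}(x)\right]^2}{4}.$$ (h) For all $\alpha,x,y>0$, $$\frac{2\Gamma\left(\frac{\alpha+1}{2}\right)}{\sqrt{\pi}\,\Gamma\left(\frac{\alpha}{2}\right)}\operatorname{Ki}_{\alpha}(x)\operatorname{Ki}_{\alpha}(y)\leq\operatorname{Ki}_{\alpha}(x+y)\leq\operatorname{Ki}_{\alpha}(x)+\operatorname{Ki}_{\alpha}(y)\leq\operatorname{Ki}_\alpha(x+y)+\frac{\sqrt{\pi}\,\Gamma\left(\frac{\alpha}{2}\right)}{2\Gamma\left(\frac{\alpha+1}{2}\right)}.$$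 Moreover, if $r,s\geq1$, then for all $\alpha,x,y>0$, $$r\operatorname{Ki}_\alpha(x)+s\operatorname{Ki}_\alpha(y)\leq\operatorname{Ki}_\alpha(rx+sy)+(r+s-1)\frac{\sqrt{\pi}\,\Gamma\left(\frac{\alpha}{2}\right)}{2\Gamma\left(\frac{\alpha+1}{2}\right)}.$$ (i) For all $\alpha,\beta>0$ and $x>0$, $$\frac{1}{\operatorname{Ki}_0(x)}\operatorname{Ki}_{\alpha}(x)\operatorname{Ki}_{\beta}(x)\leq\operatorname{Ki}_{\alpha+\beta}(x)\leq\operatorname{Ki}_{\alpha}(x)+\operatorname{Ki}_{\beta}(x)\leq\operatorname{Ki}_0(x)+\operatorname{Ki}_{\alpha+\beta}(x).$$ (j) The function $x\mapsto\operatorname{Ki}_{\alpha}(x)$ is exponentially convex on $(0,\infty)$ for all $\alpha>0$. (k) The function $\alpha\mapsto\operatorname{Ki}_{\alpha}(x)$ is exponentially convex on $\mathbb{R}$ for all $x>0$. (l) For all $\alpha,\beta\in\mathbb{R}$ and $x>0$, $$\operatorname{Ki}_{\alpha+\beta}(x)+\operatorname{Ki}_{\alpha-\beta}(x)\geq2\operatorname{Ki}_\alpha(x).$$ (m) For all $\alpha,\nu,\mu\in\mathbb{R}$ and $x>0$, $$\operatorname{Ki}_{\alpha+\nu}(x)\operatorname{Ki}_{\alpha-\mu}(x)+\operatorname{Ki}_{\alpha-\nu}(x)\operatorname{Ki}_{\alpha+\mu}(x)\geq2\left[\operatorname{Ki}_\alpha(x)\right]^2.$$ (n) The function $(\alpha,x)\mapsto\operatorname{Ki}_{\alpha}(x)$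 is (jointly) log-convex on $\mathbb{R}\times(0,\infty)$. In particular, $$\left[\operatorname{Ki}_{\alpha}(x)\right]^2\leq\operatorname{Ki}_{\alpha(1+\mu)}((1+\nu)x)\,\operatorname{Ki}_{\alpha(1-\mu)}((1-\nu)x)$$ for all $\alpha,\mu\in\mathbb{R}$, all $\nu\in(-1,1)$ and all $x>0$.
   Context: $\operatorname{Ki}_{\alpha}$ is the Bickley function, defined for every real $\alpha$ and $x>0$ by the integral in the claim; $\Gamma$ is the Euler gamma function. Completely monotonic: a real function $f$ on an open interval $I$ ($I=(0,\infty)$ or $I=\mathbb{R}$) is completely monotonic if it has derivatives of all orders and $(-1)^mf^{(m)}(x)\geq0$ for all $x\in I$ and $m\in\{0,1,2,\dots\}$. Exponentially convex: a function $f:I\to\mathbb{R}$ on an interval $I\subseteq\mathbb{R}$ is exponentially convex if it is continuous and $\sum_{j,k=1}^n\xi_j\xi_kf(x_j+x_k)\geq0$ for all $n\in\{1,2,\dots\}$, all $\xi_1,\dots,\xi_n\in\mathbb{R}$ and all real $x_1,\dots,x_n$ such that $x_j+x_k\in I$ for all $j,k\in\{1,\dots,n\}$. Log-convex: a positive function $h$ on a convex set is log-convex if $\ln h$ is convex, i.e. $h(\lambda u+(1-\lambda)v)\leq[h(u)]^{\lambda}[h(v)]^{1-\lambda}$ for all $u,v$ in the set and $\lambda\in[0,1]$. Geometrically concave: a function $q:(0,\infty)\to(0,\infty)$ is geometrically concave if $q(x^{\lambda}y^{1-\lambda})\geq[q(x)]^{\lambda}[q(y)]^{1-\lambda}$ for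 all $x,y>0$ and $\lambda\in[0,1]$. Relative convexity: if $\varphi,\psi$ are continuous real functions on an interval $I$ and $\psi$ is strictly monotone, then $\varphi$ is convex with respect to $\psi$ if $\varphi\circ\psi^{-1}$ is convex in the usual sense on the interval $\psi(I)$. *)

theory Defs
  imports "HOL-Analysis.Analysis"
begin

(* The integral converges absolutely exactly if x > 0, or x = 0 and \<alpha> > 0; elsewhere the
   value is the library's default 0, and no statement should rely on it. *)
definition Ki :: "real \<Rightarrow> real \<Rightarrow> real" where
  "Ki \<alpha> x = (LBINT t:{0..}. exp (- x * cosh t) * cosh t powr (- \<alpha>))"

(* Intended for open intervals I, where the unrestricted derivative iterates depend only on
   the values of f on I. Differentiability is required explicitly because deriv is total. *)
definition completely_monotonic_on :: "real set \<Rightarrow> (real \<Rightarrow> real) \<Rightarrow> bool" where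
  "completely_monotonic_on I f \<longleftrightarrow>
     (\<forall>m. \<forall>x\<in>I. (deriv ^^ m) f differentiable (at x) \<and> 0 \<le> (- 1) ^ m * (deriv ^^ m) f x)"

definition exponentially_convex_on :: "real set \<Rightarrow> (real \<Rightarrow> real) \<Rightarrow> bool" where
  "exponentially_convex_on I f \<longleftrightarrow> continuous_on I f \<and>
     (\<forall>n\<ge>1. \<forall>\<xi> x :: nat \<Rightarrow> real. (\<forall>j\<in>{1..n}. \<forall>k\<in>{1..n}. x j + x k \<in> I) \<longrightarrow>
        0 \<le> (\<Sum>j=1..n. \<Sum>k=1..n. \<xi> j * \<xi> k * f (x j + x k)))"

definition log_convex_on :: "'a::real_vector set \<Rightarrow> ('a \<Rightarrow> real) \<Rightarrow> bool" where
  "log_convex_on S h \<longleftrightarrow> (\<forall>u\<in>S. 0 < h u) \<and> convex_on S (\<lambda>u. ln (h u))"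

(* A property of the restriction of q to the positive reals. *)
definition geometrically_concave :: "(real \<Rightarrow> real) \<Rightarrow> bool" where
  "geometrically_concave q \<longleftrightarrow> (\<forall>x>0. 0 < q x) \<and>
     (\<forall>x>0. \<forall>y>0. \<forall>c\<in>{0..1}.
        q (x powr c * y powr (1 - c)) \<ge> q x powr c * q y powr (1 - c))"

definition convex_on_wrt :: "real set \<Rightarrow> (real \<Rightarrow> real) \<Rightarrow> (real \<Rightarrow> real) \<Rightarrow> bool" where
  "convex_on_wrt I \<phi> \<psi> \<longleftrightarrow> is_interval I \<and> continuous_on I \<phi> \<and> continuous_on I \<psi> \<and>
     (strict_mono_on I \<psi> \<or> strict_antimono_on I \<psi>) \<and>
     convex_on (\<psi> ` I) (\<phi> \<circ> inv_into I \<psi>)"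

end

(* Substituting c = cosh t, every claim except (e) and the value at 0 is a pointwise statement about the
   kernel exp (- x c - \<alpha> ln c), which is log-affine in (\<alpha>, x): log-convexity is Hoelder's inequality,
   the product inequalities follow by majorization, and the derivatives in x and \<alpha> only lower \<alpha>
   or produce a factor - ln c.

   For (e) one shows that p = x Ki_{\<alpha>-1}(x) / Ki_\<alpha>(x) is increasing, by induction on \<alpha>.
   For \<alpha> = -1, Bessel's equation shows that F = x^2 Ki_{-2}^2 - (x^2 + 1) Ki_{-1}^2, a positive
   multiple of p', satisfies F' = - 2 x Ki_{-1}^2; as F tends to 0 at infinity, F is nonnegative.
   For the step from h = Ki_\<alpha> to H = Ki_{\<alpha>+1}, the function E = H + x h - H p satisfies
   E' = - H p' and tends to 0, so it is nonnegative, and it is a positive multiple of the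
   derivative for \<alpha> + 1.

   The value Ki_\<alpha>(0) is a Beta integral after u = 1 / (cosh t)^2. *)
theory Submission
  imports Defs "HOL-Real_Asymp.Real_Asymp"
begin

section \<open>Differentiation under the integral sign\<close>

text \<open>Dominated convergence for the difference quotients along an arbitrary sequence tending
  to \<open>x0\<close>: by the mean value theorem a bound \<open>g\<close> on \<open>f'\<close> over
  all of (a, b) also bounds the quotients.\<close>

lemma has_real_derivative_lebesgue_integral:
  fixes f f' :: "real \<Rightarrow> 'a \<Rightarrow> real"
  assumes "a < x0" "x0 < b"
    and int: "\<And>x. a < x \<Longrightarrow> x < b \<Longrightarrow> integrable M (f x)"
    and der: "\<And>x t. a < x \<Longrightarrow> x < b \<Longrightarrow> t \<in> space M \<Longrightarrow>
                ((\<lambda>x. f x t) has_real_derivative f' x t) (at x)"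
    and meas: "f' x0 \<in> borel_measurable M"
    and bound: "\<And>x t. a < x \<Longrightarrow> x < b \<Longrightarrow> t \<in> space M \<Longrightarrow> \<bar>f' x t\<bar> \<le> g t"
    and g: "integrable M g"
  shows "((\<lambda>x. LINT t|M. f x t) has_real_derivative (LINT t|M. f' x0 t)) (at x0)"
  unfolding has_field_derivative_iff tendsto_at_iff_sequentially
proof (intro allI impI)
  fix X :: "nat \<Rightarrow> real"
  assume X: "\<forall>i. X i \<in> UNIV - {x0}" and lim: "X \<longlonglongrightarrow> x0"
  have "eventually (\<lambda>n. X n \<in> {a<..<b}) sequentially"
    using lim assms(1,2) by (intro topological_tendstoD) auto
  then obtain N where N: "\<And>n. n \<ge> N \<Longrightarrow> a < X n \<and> X n < b"
    by (auto simp: eventually_sequentially)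
  \<comment> \<open>The shift by \<open>N\<close> puts every term of the sequence into (a, b);
    \<open>LIMSEQ_offset\<close> undoes it at the end.\<close>
  let ?q = "\<lambda>n t. (f (X (n + N)) t - f x0 t) / (X (n + N) - x0)"
  have XN: "a < X (n + N)" "X (n + N) < b" "X (n + N) \<noteq> x0" for n
    using N[of "n + N"] X by auto
  have lim': "(\<lambda>n. X (n + N)) \<longlonglongrightarrow> x0"
    using lim by (rule LIMSEQ_ignore_initial_segment)
  have intq: "integrable M (?q n)" for n
    using int XN assms(1,2) by (intro integrable_divide Bochner_Integration.integrable_diff) auto
  have "(\<lambda>n. LINT t|M. ?q n t) \<longlonglongrightarrow> (LINT t|M. f' x0 t)"
  proof (rule integral_dominated_convergence[OF meas _ g])
    show "?q n \<in> borel_measurable M" for n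
      using intq by auto
    show "AE t in M. (\<lambda>n. ?q n t) \<longlonglongrightarrow> f' x0 t"
    proof (rule AE_I2)
      fix t assume "t \<in> space M"
      with der[of x0 t] assms(1,2)
      have "((\<lambda>x. (f x t - f x0 t) / (x - x0)) \<longlongrightarrow> f' x0 t) (at x0)"
        by (simp add: has_field_derivative_iff)
      then show "(\<lambda>n. ?q n t) \<longlonglongrightarrow> f' x0 t"
        using XN(3) lim' by (auto simp: tendsto_at_iff_sequentially comp_def)
    qed
    show "AE t in M. norm (?q n t) \<le> g t" for n
    proof (rule AE_I2)
      fix t assume t: "t \<in> space M"
      have "\<bar>f (X (n + N)) t - f x0 t\<bar> \<le> g t * \<bar>X (n + N) - x0\<bar>"
        using field_differentiable_bound[of "{a<..<b}" "\<lambda>x. f x t" "\<lambda>x. f' x t" "g t" "X (n + N)" x0]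
          der t bound XN assms(1,2)
        by (auto intro: has_field_derivative_at_within)
      then show "norm (?q n t) \<le> g t"
        using XN(3) by (simp add: abs_divide pos_divide_le_eq)
    qed
  qed
  also have "(\<lambda>n. LINT t|M. ?q n t) = (\<lambda>n. ((\<lambda>y. ((LINT t|M. f y t) - (LINT t|M. f x0 t)) / (y - x0)) \<circ> X) (n + N))"
    using int XN assms(1,2) by (simp add: fun_eq_iff Bochner_Integration.integral_diff)
  finally show "((\<lambda>y. ((LINT t|M. f y t) - (LINT t|M. f x0 t)) / (y - x0)) \<circ> X)
                 \<longlonglongrightarrow> (LINT t|M. f' x0 t)"
    by (rule LIMSEQ_offset)
qed

section \<open>The half-line measure and elementary bounds\<close>

abbreviation half_line :: "real measure" where
  "half_line \<equiv> restrict_space lborel {0..}"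

lemma space_half_line: "space half_line = {0..}"
  by (simp add: space_restrict_space)

lemma measurable_half_line: "f \<in> borel_measurable borel \<Longrightarrow> f \<in> borel_measurable half_line"
  by (intro measurable_restrict_space1) simp

text \<open>Makes the almost-everywhere filter of \<open>half_line\<close> nontrivial, which later
  turns pointwise positivity of the kernel into positivity of its integral.\<close>

lemma emeasure_half_line_space: "emeasure half_line (space half_line) \<noteq> 0"
proof -
  have "emeasure lborel {0..1::real} \<le> emeasure lborel {0::real..}"
    by (intro emeasure_mono) auto
  then show ?thesis
    by (auto simp: emeasure_restrict_space space_half_line)
qed

lemma integrable_exp_half_line:
  assumes "a > 0"
  shows "integrable half_line (\<lambda>t. exp (- a * t) :: real)"
proof -
  have "(\<lambda>t::real. exp (- a * t)) absolutely_integrable_on {0..}"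
    using integrable_on_exp_minus_to_infinity[OF assms]
    by (intro nonnegative_absolutely_integrable_1) auto
  \<comment> \<open>Absolute integrability refers to the completed measure; for a Borel function it
    amounts to integrability over \<open>lborel\<close>.\<close>
  then have "integrable lborel (\<lambda>t. indicator {0..} t *\<^sub>R exp (- a * t) :: real)"
    unfolding set_integrable_def
    by (subst (asm) integrable_completion) auto
  then show ?thesis
    by (simp add: integrable_restrict_space)
qed

lemma cosh_ge_exp: "cosh t \<ge> exp t / (2::real)"
  by (simp add: cosh_field_def)

lemma ln_cosh_nonneg: "ln (cosh (t::real)) \<ge> 0"
  using cosh_real_ge_1[of t] by simp

lemma ln_cosh_le_cosh: "ln (cosh (t::real)) \<le> cosh t"
  using ln_le_minus_one[of "cosh t"] by simp

text \<open>One term of the exponential series with nonnegative terms is at most its sum.\<close>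

lemma power_exp_neg_le:
  fixes y :: real
  assumes "y \<ge> 0"
  shows "y ^ n * exp (- y) \<le> fact n"
proof -
  have sums: "(\<lambda>k. y ^ k / fact k) sums exp y"
    using exp_converges[of y] by (simp add: divide_inverse mult.commute)
  have "y ^ n / fact n = (\<Sum>k\<in>{n}. y ^ k / fact k)"
    by simp
  also have "\<dots> \<le> (\<Sum>k. y ^ k / fact k)"
    using assms sums by (intro sum_le_suminf) (auto simp: sums_iff)
  also have "\<dots> = exp y"
    using sums by (simp add: sums_iff)
  finally show ?thesis
    by (simp add: exp_minus field_simps)
qed

section \<open>The kernel family and its integrability\<close>

text \<open>The logarithmic factor arises from m differentiations in \<alpha>. Writing the power of
  cosh through \<open>ln\<close> makes the exponent visibly affine in (\<alpha>, x).\<close>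

definition kernel :: "nat \<Rightarrow> real \<Rightarrow> real \<Rightarrow> real \<Rightarrow> real" where
  "kernel m \<alpha> x t = exp (- x * cosh t - \<alpha> * ln (cosh t)) * ln (cosh t) ^ m"

text \<open>For x > 0 this is (-1)^m times the m-th derivative of Ki in the order; m = 0 gives
  \<open>Ki\<close> itself.\<close>

definition KI :: "nat \<Rightarrow> real \<Rightarrow> real \<Rightarrow> real" where
  "KI m \<alpha> x = (LINT t|half_line. kernel m \<alpha> x t)"

lemma kernel_nonneg: "0 \<le> kernel m \<alpha> x t"
  by (simp add: kernel_def ln_cosh_nonneg)

lemma kernel_0_pos: "0 < kernel 0 \<alpha> x t"
  by (simp add: kernel_def)

lemma kernel_antimono:
  assumes "\<alpha> \<le> \<beta>" "x \<le> y"
  shows "kernel m \<beta> y t \<le> kernel m \<alpha> x t"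
  unfolding kernel_def using assms
  by (intro mult_right_mono) (auto intro!: add_mono mult_right_mono ln_cosh_nonneg diff_mono zero_le_power)

text \<open>Differentiation in x brings down a factor -cosh t, which therefore amounts to a sign and
  a lowering of the order by one.\<close>

lemma kernel_times_cosh: "cosh t * kernel m \<alpha> x t = kernel m (\<alpha> - 1) x t"
proof -
  have "exp (- x * cosh t - (\<alpha> - 1) * ln (cosh t)) = exp (ln (cosh t)) * exp (- x * cosh t - \<alpha> * ln (cosh t))"
    unfolding exp_add[symmetric] by (simp add: algebra_simps)
  then show ?thesis
    by (simp add: kernel_def)
qed

lemma measurable_kernel: "kernel m \<alpha> x \<in> borel_measurable half_line"
  unfolding kernel_def
  by (intro measurable_half_line borel_measurable_continuous_onI continuous_intros) auto

lemma kernel_0_powr: "kernel 0 \<alpha> x t = exp (- x * cosh t) * cosh t powr (- \<alpha>)"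
  by (simp add: kernel_def powr_def exp_add[symmetric])

lemma Ki_eq_KI: "Ki \<alpha> = KI 0 \<alpha>"
  by (simp add: fun_eq_iff Ki_def KI_def kernel_0_powr set_lebesgue_integral_def
      integral_restrict_space)

text \<open>All powers of cosh t are absorbed by exp (-x cosh t), leaving a multiple of 1 / cosh t
  and hence of exp (-t).\<close>

lemma integrable_kernel:
  assumes "x > 0"
  shows "integrable half_line (kernel m \<alpha> x)"
proof -
  \<comment> \<open>\<open>n\<close> bounds the total power of cosh t: the rounded-up |\<alpha>| for
    the order and m for the logarithms, each at most cosh t.\<close>
  define n where "n = nat \<lceil>\<bar>\<alpha>\<bar>\<rceil> + m"
  define C where "C = 2 * fact (Suc n) / x ^ Suc n"
  have "norm (kernel m \<alpha> x t) \<le> norm (C * exp (- 1 * t))" for t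
  proof -
    have c: "cosh t \<ge> 1" "cosh t > 0" by (auto simp: cosh_real_ge_1)
    have "kernel 0 \<alpha> x t = exp (- x * cosh t) * cosh t powr (- \<alpha>)"
      by (rule kernel_0_powr)
    also have "\<dots> \<le> exp (- x * cosh t) * cosh t powr (real (nat \<lceil>\<bar>\<alpha>\<bar>\<rceil>))"
      using c by (intro mult_left_mono powr_mono) (simp, linarith, auto)
    also have "\<dots> = exp (- x * cosh t) * cosh t ^ nat \<lceil>\<bar>\<alpha>\<bar>\<rceil>"
      using c by (simp only: powr_realpow)
    finally have k0: "kernel 0 \<alpha> x t \<le> exp (- x * cosh t) * cosh t ^ nat \<lceil>\<bar>\<alpha>\<bar>\<rceil>" .
    have "kernel m \<alpha> x t = kernel 0 \<alpha> x t * ln (cosh t) ^ m"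
      by (simp add: kernel_def)
    also have "\<dots> \<le> (exp (- x * cosh t) * cosh t ^ nat \<lceil>\<bar>\<alpha>\<bar>\<rceil>) * cosh t ^ m"
      using k0 by (intro mult_mono power_mono ln_cosh_le_cosh ln_cosh_nonneg zero_le_power) auto
    also have "\<dots> = exp (- x * cosh t) * cosh t ^ n"
      by (simp add: n_def power_add)
    \<comment> \<open>One power more than \<open>n\<close> is inserted so that a factor 1 / cosh t
      is left over.\<close>
    also have "\<dots> = ((x * cosh t) ^ Suc n * exp (- (x * cosh t))) / (x ^ Suc n * cosh t)"
      using assms c by (simp add: power_mult_distrib field_simps)
    also have "\<dots> \<le> fact (Suc n) / (x ^ Suc n * cosh t)"
      using assms c by (intro divide_right_mono power_exp_neg_le) auto
    also have "\<dots> = fact (Suc n) / x ^ Suc n * (1 / cosh t)"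
      by simp
    also have "\<dots> \<le> fact (Suc n) / x ^ Suc n * (2 * exp (- t))"
      using cosh_ge_exp[of t] assms c
      by (intro mult_left_mono) (auto simp: exp_minus field_simps)
    also have "\<dots> = C * exp (- 1 * t)"
      by (simp add: C_def)
    finally show ?thesis
      using kernel_nonneg[of m \<alpha> x t] by simp
  qed
  moreover have "integrable half_line (\<lambda>t. C * exp (- 1 * t))"
    by (intro integrable_mult_right integrable_exp_half_line) simp
  ultimately show ?thesis
    by (rule Bochner_Integration.integrable_bound[OF _ measurable_kernel AE_I2, rotated])
qed

text \<open>At x = 0 the exponential factor is 1, and decay comes only from the negative power of
  cosh t >= exp t / 2; this is where \<alpha> > 0 enters.\<close>

lemma integrable_kernel_0:
  assumes "\<alpha> > 0"
  shows "integrable half_line (kernel 0 \<alpha> 0)"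
proof -
  have "norm (kernel 0 \<alpha> 0 t) \<le> norm (2 powr \<alpha> * exp (- \<alpha> * t))" for t
  proof -
    have "cosh t powr (- \<alpha>) \<le> (exp t / 2) powr (- \<alpha>)"
      using cosh_ge_exp[of t] assms by (intro powr_mono2') auto
    also have "\<dots> = 2 powr \<alpha> * exp (- \<alpha> * t)"
      by (simp add: powr_def ln_div exp_add[symmetric] algebra_simps)
    finally show ?thesis
      by (simp add: kernel_0_powr)
  qed
  moreover have "integrable half_line (\<lambda>t. 2 powr \<alpha> * exp (- \<alpha> * t))"
    by (intro integrable_mult_right integrable_exp_half_line assms)
  ultimately show ?thesis
    by (rule Bochner_Integration.integrable_bound[OF _ measurable_kernel AE_I2, rotated])
qed

lemma KI_nonneg: "0 \<le> KI m \<alpha> x"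
  unfolding KI_def by (intro integral_nonneg_AE) (auto simp: kernel_nonneg)

section \<open>Derivatives in the order and in the argument\<close>

text \<open>The kernel decreases in the order, so its value at order \<alpha> - 1 dominates the
  derivative on all of (\<alpha> - 1, \<alpha> + 1).\<close>

lemma KI_has_real_derivative_order:
  assumes "x > 0"
  shows "((\<lambda>\<alpha>. KI m \<alpha> x) has_real_derivative - KI (Suc m) \<alpha> x) (at \<alpha>)"
proof -
  have "((\<lambda>\<alpha>. LINT t|half_line. kernel m \<alpha> x t) has_real_derivative
          (LINT t|half_line. - kernel (Suc m) \<alpha> x t)) (at \<alpha>)"
  proof (rule has_real_derivative_lebesgue_integral[where a = "\<alpha> - 1" and b = "\<alpha> + 1"
        and g = "kernel (Suc m) (\<alpha> - 1) x" and f' = "\<lambda>\<alpha> t. - kernel (Suc m) \<alpha> x t"])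
    show "((\<lambda>\<alpha>. kernel m \<alpha> x t) has_real_derivative - kernel (Suc m) \<beta> x t) (at \<beta>)" for \<beta> t
      unfolding kernel_def by (auto intro!: derivative_eq_intros)
    show "\<bar>- kernel (Suc m) \<beta> x t\<bar> \<le> kernel (Suc m) (\<alpha> - 1) x t" if "\<alpha> - 1 < \<beta>" for \<beta> t
      using kernel_antimono[of "\<alpha> - 1" \<beta> x x "Suc m" t] that
      by (simp add: kernel_nonneg)
  qed (use assms in \<open>auto intro: integrable_kernel borel_measurable_uminus measurable_kernel\<close>)
  then show ?thesis
    by (simp add: KI_def)
qed

text \<open>The neighbourhood starts at x / 2 because the kernel at its left end serves as the
  dominating function and must be integrable.\<close>

lemma KI_has_real_derivative:
  assumes "x > 0"
  shows "(KI m \<alpha> has_real_derivative - KI m (\<alpha> - 1) x) (at x)"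
proof -
  have "((\<lambda>x. LINT t|half_line. kernel m \<alpha> x t) has_real_derivative
          (LINT t|half_line. - kernel m (\<alpha> - 1) x t)) (at x)"
  proof (rule has_real_derivative_lebesgue_integral[where a = "x / 2" and b = "x + 1"
        and g = "kernel m (\<alpha> - 1) (x / 2)" and f' = "\<lambda>x t. - kernel m (\<alpha> - 1) x t"])
    show "((\<lambda>x. kernel m \<alpha> x t) has_real_derivative - kernel m (\<alpha> - 1) y t) (at y)" for y t
      unfolding kernel_times_cosh[symmetric] unfolding kernel_def
      by (auto intro!: derivative_eq_intros)
    show "\<bar>- kernel m (\<alpha> - 1) y t\<bar> \<le> kernel m (\<alpha> - 1) (x / 2) t" if "x / 2 < y" for y t
      using kernel_antimono[of "\<alpha> - 1" "\<alpha> - 1" "x / 2" y m t] that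
      by (simp add: kernel_nonneg)
  qed (use assms in \<open>auto intro: integrable_kernel borel_measurable_uminus measurable_kernel\<close>)
  then show ?thesis
    by (simp add: KI_def[abs_def])
qed

section \<open>Positivity and log-convexity\<close>

text \<open>The boundary piece x = 0, \<alpha> > 0 is included so that one log-convexity proof also
  covers the value at 0.\<close>

definition Ki_domain :: "(real \<times> real) set" where
  "Ki_domain = {(\<alpha>, x). 0 < x \<or> (x = 0 \<and> 0 < \<alpha>)}"

lemma integrable_kernel_domain:
  "(\<alpha>, x) \<in> Ki_domain \<Longrightarrow> integrable half_line (kernel 0 \<alpha> x)"
  by (auto simp: Ki_domain_def intro: integrable_kernel integrable_kernel_0)

lemma KI_pos:
  assumes "(\<alpha>, x) \<in> Ki_domain"
  shows "0 < KI 0 \<alpha> x"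
proof (rule ccontr)
  assume "\<not> 0 < KI 0 \<alpha> x"
  then have "KI 0 \<alpha> x = 0"
    using KI_nonneg[of 0 \<alpha> x] by simp
  then have "AE t in half_line. kernel 0 \<alpha> x t = 0"
    using integral_nonneg_eq_0_iff_AE[OF integrable_kernel_domain[OF assms]]
    by (simp add: KI_def kernel_nonneg)
  then have "AE t in half_line. False"
    by (rule eventually_mono) (metis kernel_0_pos less_irrefl)
  then show False
    using emeasure_half_line_space by (simp add: eventually_False ae_filter_eq_bot_iff)
qed

lemma KI_pos': "0 < x \<Longrightarrow> 0 < KI 0 \<alpha> x"
  by (rule KI_pos) (simp add: Ki_domain_def)

text \<open>This is Hoelder's inequality, proved directly: both kernels are divided by their
  integrals, convexity of exp is applied pointwise, and the normalized kernels integrate to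
  1.\<close>

lemma log_convex_on_Ki:
  assumes S: "convex S" "S \<subseteq> Ki_domain"
  shows "log_convex_on S (\<lambda>(\<alpha>, x). Ki \<alpha> x)"
  unfolding log_convex_on_def
proof (intro conjI ballI convex_onI)
  show pos: "0 < (case u of (\<alpha>, x) \<Rightarrow> Ki \<alpha> x)" if "u \<in> S" for u
    using that S(2) by (cases u) (auto simp: Ki_eq_KI intro!: KI_pos)
  show "convex S"
    by fact
  fix t :: real and u v :: "real \<times> real"
  assume t: "0 < t" "t < 1" and uv: "u \<in> S" "v \<in> S"
  obtain \<alpha> x \<beta> y where [simp]: "u = (\<alpha>, x)" "v = (\<beta>, y)"
    by (cases u, cases v)
  define \<gamma> z where "\<gamma> = (1 - t) * \<alpha> + t * \<beta>" and "z = (1 - t) * x + t * y"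
  have w: "(1 - t) *\<^sub>R u + t *\<^sub>R v = (\<gamma>, z)"
    by (simp add: \<gamma>_def z_def)
  have "(\<gamma>, z) \<in> S"
    using convexD[OF S(1) uv, of "1 - t" t] t unfolding w by simp
  then have int: "integrable half_line (kernel 0 \<gamma> z)" "integrable half_line (kernel 0 \<alpha> x)"
      "integrable half_line (kernel 0 \<beta> y)"
    using S(2) uv by (auto intro: integrable_kernel_domain)
  have p: "KI 0 \<alpha> x > 0" "KI 0 \<beta> y > 0" "KI 0 \<gamma> z > 0"
    using pos[OF uv(1)] pos[OF uv(2)] pos[OF \<open>(\<gamma>, z) \<in> S\<close>] by (auto simp: Ki_eq_KI)
  \<comment> \<open>exp L is the weighted geometric mean of the two integrals, the bound to be
    reached.\<close>
  define L where "L = (1 - t) * ln (KI 0 \<alpha> x) + t * ln (KI 0 \<beta> y)"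
  let ?b = "\<lambda>s. exp L * ((1 - t) * (kernel 0 \<alpha> x s / KI 0 \<alpha> x) + t * (kernel 0 \<beta> y s / KI 0 \<beta> y))"
  have "KI 0 \<gamma> z \<le> (LINT s|half_line. ?b s)"
    unfolding KI_def[of 0 \<gamma> z]
  proof (rule integral_mono)
    fix s
    let ?a = "- x * cosh s - \<alpha> * ln (cosh s) - ln (KI 0 \<alpha> x)"
    let ?c = "- y * cosh s - \<beta> * ln (cosh s) - ln (KI 0 \<beta> y)"
    have "kernel 0 \<gamma> z s = exp L * exp ((1 - t) *\<^sub>R ?a + t *\<^sub>R ?c)"
      by (simp add: kernel_def exp_add[symmetric] L_def \<gamma>_def z_def algebra_simps)
    also have "\<dots> \<le> exp L * ((1 - t) * exp ?a + t * exp ?c)"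
      using t by (intro mult_left_mono convex_onD[OF exp_convex]) auto
    also have "exp ?a = kernel 0 \<alpha> x s / KI 0 \<alpha> x"
      unfolding exp_diff[of _ "ln (KI 0 \<alpha> x)"] using p by (simp add: kernel_def)
    also have "exp ?c = kernel 0 \<beta> y s / KI 0 \<beta> y"
      unfolding exp_diff[of _ "ln (KI 0 \<beta> y)"] using p by (simp add: kernel_def)
    finally show "kernel 0 \<gamma> z s \<le> ?b s" .
  qed (use int in auto)
  also have "\<dots> = exp L * ((1 - t) * (KI 0 \<alpha> x / KI 0 \<alpha> x) + t * (KI 0 \<beta> y / KI 0 \<beta> y))"
    using int by (simp add: KI_def)
  also have "\<dots> = exp L"
    using p by simp
  finally have "ln (KI 0 \<gamma> z) \<le> L"
    using p ln_mono[of "KI 0 \<gamma> z" "exp L"] by simp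
  then show "ln (case (1 - t) *\<^sub>R u + t *\<^sub>R v of (\<alpha>, x) \<Rightarrow> Ki \<alpha> x) \<le>
      (1 - t) * ln (case u of (\<alpha>, x) \<Rightarrow> Ki \<alpha> x) + t * ln (case v of (\<alpha>, x) \<Rightarrow> Ki \<alpha> x)"
    unfolding w by (simp add: Ki_eq_KI L_def)
qed

lemma convex_mult_halfspace: "convex (UNIV \<times> {0<..} :: (real \<times> real) set)"
  by (intro convex_Times convex_real_interval convex_UNIV)

lemma log_convex_on_Ki_joint: "log_convex_on (UNIV \<times> {0<..}) (\<lambda>(\<alpha>, x). Ki \<alpha> x)"
  by (intro log_convex_on_Ki convex_mult_halfspace) (auto simp: Ki_domain_def)

lemma log_convex_on_slice_fst:
  assumes h: "log_convex_on (S \<times> {y}) h"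
  shows "log_convex_on S (\<lambda>u. h (u, y))"
  unfolding log_convex_on_def
proof (intro conjI ballI convex_onI)
  show "0 < h (u, y)" if "u \<in> S" for u
    using h that by (auto simp: log_convex_on_def)
  have "convex (fst ` (S \<times> {y}))"
    using h by (intro convex_linear_image) (auto simp: log_convex_on_def convex_on_def linear_fst)
  then show "convex S"
    by simp
  fix t :: real and u v assume "0 < t" "t < 1" "u \<in> S" "v \<in> S"
  then show "ln (h ((1 - t) *\<^sub>R u + t *\<^sub>R v, y)) \<le> (1 - t) * ln (h (u, y)) + t * ln (h (v, y))"
    using h convex_onD[of "S \<times> {y}" "\<lambda>u. ln (h u)" t "(u, y)" "(v, y)"]
    by (auto simp: log_convex_on_def simp flip: scaleR_add_left)
qed

lemma log_convex_on_slice_snd: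
  assumes h: "log_convex_on ({y} \<times> S) h"
  shows "log_convex_on S (\<lambda>u. h (y, u))"
  unfolding log_convex_on_def
proof (intro conjI ballI convex_onI)
  show "0 < h (y, u)" if "u \<in> S" for u
    using h that by (auto simp: log_convex_on_def)
  have "convex (snd ` ({y} \<times> S))"
    using h by (intro convex_linear_image) (auto simp: log_convex_on_def convex_on_def linear_snd)
  then show "convex S"
    by simp
  fix t :: real and u v assume "0 < t" "t < 1" "u \<in> S" "v \<in> S"
  then show "ln (h (y, (1 - t) *\<^sub>R u + t *\<^sub>R v)) \<le> (1 - t) * ln (h (y, u)) + t * ln (h (y, v))"
    using h convex_onD[of "{y} \<times> S" "\<lambda>u. ln (h u)" t "(y, u)" "(y, v)"]
    by (auto simp: log_convex_on_def simp flip: scaleR_add_left)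
qed

lemma log_convex_on_Ki_order: "x > 0 \<Longrightarrow> log_convex_on UNIV (\<lambda>\<alpha>. Ki \<alpha> x)"
  using log_convex_on_slice_fst[OF log_convex_on_Ki[of "UNIV \<times> {x}"]]
  by (auto simp: Ki_domain_def intro: convex_Times)

lemma log_convex_on_Ki_argument: "log_convex_on {0<..} (\<lambda>x. Ki \<alpha> x)"
  using log_convex_on_slice_snd[OF log_convex_on_Ki[of "{\<alpha>} \<times> {0<..}"]]
  by (auto simp: Ki_domain_def intro: convex_Times)

text \<open>The endpoint 0 is kept because the product inequality in the argument compares the pair
  x, y with the pair 0, x + y.\<close>

lemma log_convex_on_Ki_argument_0: "\<alpha> > 0 \<Longrightarrow> log_convex_on {0..} (\<lambda>x. Ki \<alpha> x)"
proof -
  assume "\<alpha> > 0"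
  then have "{\<alpha>} \<times> {0..} \<subseteq> Ki_domain"
    by (force simp: Ki_domain_def)
  from log_convex_on_slice_snd[OF log_convex_on_Ki[OF convex_Times this]]
  show ?thesis
    by simp
qed

text \<open>The two convexity inequalities carry weights t and 1 - t in opposite order, so on adding
  them ln (h u) and ln (h v) each get total weight 1.\<close>

lemma log_convex_on_majorization:
  assumes h: "log_convex_on S h" and uv: "u \<in> S" "v \<in> S" and t: "0 \<le> t" "t \<le> 1"
  shows "h ((1 - t) *\<^sub>R u + t *\<^sub>R v) * h (t *\<^sub>R u + (1 - t) *\<^sub>R v) \<le> h u * h v"
proof -
  have cv: "convex_on S (\<lambda>u. ln (h u))" and pos: "\<And>u. u \<in> S \<Longrightarrow> 0 < h u"
    using h by (auto simp: log_convex_on_def)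
  let ?a = "(1 - t) *\<^sub>R u + t *\<^sub>R v" and ?b = "t *\<^sub>R u + (1 - t) *\<^sub>R v"
  have ab: "?a \<in> S" "?b \<in> S"
    using convex_on_imp_convex[OF cv] uv t by (auto intro!: convexD)
  have "ln (h ?a * h ?b) \<le> ln (h u * h v)"
    using convex_onD[OF cv t uv] convex_onD[OF cv, of "1 - t" u v] t uv pos[OF ab(1)] pos[OF ab(2)]
      pos[OF uv(1)] pos[OF uv(2)]
    by (simp add: ln_mult algebra_simps)
  then show ?thesis
    using pos[OF ab(1)] pos[OF ab(2)] pos[OF uv(1)] pos[OF uv(2)] by simp
qed

text \<open>Of two pairs with the same sum, the inner one has the smaller product of values. The
  product inequalities in order and argument are mostly instances of this.\<close>

lemma log_convex_on_majorization_real: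
  fixes a b c d :: real
  assumes "log_convex_on S h" "a \<in> S" "b \<in> S" "a \<le> c" "c \<le> b" "c + d = a + b"
  shows "h c * h d \<le> h a * h b"
proof (cases "a = b")
  case True
  with assms have "c = a" "d = b" by auto
  then show ?thesis by simp
next
  case False
  define t where "t = (c - a) / (b - a)"
  have t: "0 \<le> t" "t \<le> 1"
    using False assms by (auto simp: t_def divide_simps)
  have "t * (b - a) = c - a"
    using False by (simp add: t_def)
  then have "(1 - t) *\<^sub>R a + t *\<^sub>R b = c" "t *\<^sub>R a + (1 - t) *\<^sub>R b = d"
    using assms(6) by (auto simp: algebra_simps)
  then show ?thesis
    using log_convex_on_majorization[OF assms(1-3) t] by simp
qed

section \<open>The Bessel equation and decay at infinity\<close>

text \<open>Dominated convergence over [0, n] with |f| as the bound; \<open>f\<close> may change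
  sign, as it does in the application to Bessel's equation.\<close>

lemma integral_half_line_FTC:
  fixes f F :: "real \<Rightarrow> real"
  assumes F: "\<And>t. (F has_real_derivative f t) (at t)" and f: "continuous_on UNIV f"
    and int: "integrable half_line f" and lim: "(F \<longlongrightarrow> L) at_top"
  shows "(LINT t|half_line. f t) = L - F 0"
proof -
  have fm: "f \<in> borel_measurable borel"
    using f by (rule borel_measurable_continuous_onI)
  have int': "integrable lborel (\<lambda>t. indicator {0..} t *\<^sub>R f t)"
    using int by (simp add: integrable_restrict_space)
  have "(\<lambda>n. LINT t|lborel. indicator {0..real n} t *\<^sub>R f t) \<longlonglongrightarrow> (LINT t|lborel. indicator {0..} t *\<^sub>R f t)"
  proof (rule integral_dominated_convergence[OF _ _ integrable_norm[OF int']])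
    show "AE t in lborel. (\<lambda>n. indicator {0..real n} t *\<^sub>R f t) \<longlonglongrightarrow> indicator {0..} t *\<^sub>R f t"
    proof (rule AE_I2, rule tendsto_eventually)
      fix t :: real
      obtain N where "t \<le> real N"
        using real_arch_simple by blast
      then show "\<forall>\<^sub>F n in sequentially. indicator {0..real n} t *\<^sub>R f t = indicator {0..} t *\<^sub>R f t"
        by (intro eventually_sequentiallyI[of N]) (auto simp: indicator_def)
    qed
    show "AE t in lborel. norm (indicator {0..real n} t *\<^sub>R f t) \<le> norm (indicator {0..} t *\<^sub>R f t)" for n
      by (auto simp: indicator_def)
  qed (use fm in auto)
  moreover have "(LINT t|lborel. indicator {0..real n} t *\<^sub>R f t) = F (real n) - F 0" for n
    using F f by (intro integral_FTC_atLeastAtMost)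
      (auto simp flip: has_real_derivative_iff_has_vector_derivative
        intro: has_field_derivative_at_within continuous_on_subset)
  moreover have "(\<lambda>n. F (real n) - F 0) \<longlonglongrightarrow> L - F 0"
    using lim filterlim_real_sequentially by (intro tendsto_intros) (rule filterlim_compose)
  ultimately have "(LINT t|lborel. indicator {0..} t *\<^sub>R f t) = L - F 0"
    using LIMSEQ_unique by simp
  then show ?thesis
    by (simp add: integral_restrict_space)
qed

text \<open>The modified Bessel equation for \<open>K\<^sub>1 = Ki\<^bsub>-1\<^esub>\<close>.\<close>

lemma KI_bessel_equation:
  assumes "x > 0"
  shows "x\<^sup>2 * KI 0 (-3) x - x * KI 0 (-2) x - (x\<^sup>2 + 1) * KI 0 (-1) x = 0"
proof -
  let ?f = "\<lambda>t. x\<^sup>2 * kernel 0 (-3) x t - x * kernel 0 (-2) x t - (x\<^sup>2 + 1) * kernel 0 (-1) x t"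
  \<comment> \<open>Since the derivatives of K_1 are -Ki_{-2} and Ki_{-3}, \<open>?f\<close> is the
    integrand of Bessel's expression. \<open>?F\<close> is an explicit antiderivative, which
    vanishes at 0 because sinh 0 = 0 and also at infinity.\<close>
  let ?F = "\<lambda>t. - ((x * cosh t * sinh t + sinh t) * exp (- x * cosh t))"
  have f: "?f t = exp (- x * cosh t) * (x\<^sup>2 * cosh t ^ 3 - x * cosh t ^ 2 - (x\<^sup>2 + 1) * cosh t)" for t
    by (simp add: kernel_0_powr algebra_simps)
  have "(LINT t|half_line. ?f t) = 0 - ?F 0"
  proof (rule integral_half_line_FTC)
    fix t
    have "?f t = exp (- x * cosh t) * (x\<^sup>2 * cosh t * sinh t ^ 2 - x * cosh t ^ 2 - cosh t)"
      unfolding f sinh_square_eq by (simp add: algebra_simps power2_eq_square power3_eq_cube)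
    also have "\<dots> = - (x * cosh t * cosh t + x * sinh t * sinh t + cosh t) * exp (- x * cosh t)
        - (x * cosh t * sinh t + sinh t) * (exp (- x * cosh t) * (- x * sinh t))"
      by (simp add: algebra_simps power2_eq_square)
    finally show "(?F has_real_derivative ?f t) (at t)"
      by (auto intro!: derivative_eq_intros simp: algebra_simps)
  next
    show "continuous_on UNIV ?f"
      unfolding f by (intro continuous_intros)
    show "integrable half_line ?f"
      using assms by (intro Bochner_Integration.integrable_diff integrable_mult_right integrable_kernel) auto
    \<comment> \<open>Bounding sinh t by cosh t turns the limit of \<open>?F\<close> into one in the
      single variable y = cosh t.\<close>
    have "((\<lambda>y. (x * y\<^sup>2 + y) * exp (- x * y)) \<longlongrightarrow> 0) at_top"
      using assms by real_asymp
    then have lim: "((\<lambda>t. (x * (cosh t)\<^sup>2 + cosh t) * exp (- x * cosh t)) \<longlongrightarrow> 0) at_top"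
      by (rule filterlim_compose[OF _ cosh_real_at_top])
    show "(?F \<longlongrightarrow> 0) at_top"
    proof (rule Lim_null_comparison[OF _ lim], rule eventually_at_top_linorderI[of 0])
      fix t :: real assume "t \<ge> 0"
      then have s: "0 \<le> sinh t" "sinh t \<le> cosh t"
        using sinh_less_cosh_real[of t] by auto
      have "norm (?F t) = (x * (cosh t * sinh t) + sinh t) * exp (- x * cosh t)"
        unfolding norm_minus_cancel using s assms by (simp add: abs_mult)
      also have "\<dots> \<le> (x * (cosh t * cosh t) + cosh t) * exp (- x * cosh t)"
        using s assms by (intro mult_right_mono add_mono mult_left_mono) auto
      finally show "norm (?F t) \<le> (x * (cosh t)\<^sup>2 + cosh t) * exp (- x * cosh t)"
        by (simp add: power2_eq_square)
    qed
  qed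
  moreover have "(LINT t|half_line. ?f t) = x\<^sup>2 * KI 0 (-3) x - x * KI 0 (-2) x - (x\<^sup>2 + 1) * KI 0 (-1) x"
    unfolding KI_def using assms
    by (subst Bochner_Integration.integral_diff
        | intro Bochner_Integration.integrable_diff integrable_mult_right integrable_kernel | simp)+
  ultimately show ?thesis
    by simp
qed

text \<open>Since cosh t >= 1, passing from argument 1 to x multiplies the kernel by at most exp (1
  - x). This decay beats every power of x and removes the boundary terms at infinity.\<close>

lemma KI_exp_bound:
  assumes "x \<ge> 1"
  shows "KI 0 \<alpha> x \<le> exp (1 - x) * KI 0 \<alpha> 1"
proof -
  have "KI 0 \<alpha> x \<le> (LINT t|half_line. exp (1 - x) * kernel 0 \<alpha> 1 t)"
    unfolding KI_def
  proof (rule integral_mono)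
    fix t
    have "(1 - x) * cosh t \<le> (1 - x) * 1"
      using assms cosh_real_ge_1[of t] by (intro mult_left_mono_neg) auto
    then have "- x * cosh t \<le> (1 - x) + - 1 * cosh t"
      by (simp add: algebra_simps)
    then have "exp (- x * cosh t) \<le> exp (1 - x) * exp (- 1 * cosh t)"
      by (simp only: exp_le_cancel_iff flip: exp_add)
    then show "kernel 0 \<alpha> x t \<le> exp (1 - x) * kernel 0 \<alpha> 1 t"
      unfolding kernel_0_powr mult.assoc[symmetric] by (rule mult_right_mono) simp
  qed (use assms in \<open>auto intro: integrable_kernel\<close>)
  then show ?thesis
    by (simp add: KI_def)
qed

lemma tendsto_power_times_KI: "((\<lambda>x. x ^ n * KI 0 \<alpha> x) \<longlongrightarrow> 0) at_top"
proof (rule Lim_null_comparison)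
  show "((\<lambda>x. x ^ n * exp (1 - x) * KI 0 \<alpha> 1) \<longlongrightarrow> 0) at_top"
    by (rule tendsto_mult_left_zero) real_asymp
  show "\<forall>\<^sub>F x in at_top. norm (x ^ n * KI 0 \<alpha> x) \<le> x ^ n * exp (1 - x) * KI 0 \<alpha> 1"
  proof (rule eventually_at_top_linorderI[of 1])
    fix x :: real assume "x \<ge> 1"
    then show "norm (x ^ n * KI 0 \<alpha> x) \<le> x ^ n * exp (1 - x) * KI 0 \<alpha> 1"
      using KI_exp_bound[of x \<alpha>] KI_nonneg[of 0 \<alpha> x] by (simp add: abs_mult mult.assoc)
  qed
qed

section \<open>Geometric concavity by induction on the order\<close>

lemma nonneg_if_deriv_nonpos_tendsto_0:
  fixes f :: "real \<Rightarrow> real"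
  assumes "\<And>y. y \<ge> x \<Longrightarrow> \<exists>d. (f has_real_derivative d) (at y) \<and> d \<le> 0"
    and "(f \<longlongrightarrow> 0) at_top"
  shows "0 \<le> f x"
proof (rule tendsto_upperbound[OF assms(2)])
  show "\<forall>\<^sub>F y in at_top. f y \<le> f x"
    using assms(1)
    by (intro eventually_at_top_linorderI[of x] DERIV_nonpos_imp_nonincreasing[of x _ f]) blast+
qed simp

lemma KI_log_convex_order:
  assumes "x > 0"
  shows "(KI 0 (\<alpha> - 1) x)\<^sup>2 \<le> KI 0 \<alpha> x * KI 0 (\<alpha> - 2) x"
  using log_convex_on_majorization_real[OF log_convex_on_Ki_order[OF assms], of "\<alpha> - 2" \<alpha> "\<alpha> - 1" "\<alpha> - 1"]
  by (simp add: Ki_eq_KI power2_eq_square mult.commute)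

text \<open>Up to the positive factor \<open>(Ki\<^sub>\<alpha> x)\<^sup>2\<close>, this is the derivative of
  \<open>x Ki\<^bsub>\<alpha>-1\<^esub> x / Ki\<^sub>\<alpha> x\<close>, the negative logarithmic slope of \<open>Ki\<^sub>\<alpha>\<close> in the variable \<open>ln x\<close>.\<close>

definition slope_deriv :: "real \<Rightarrow> real \<Rightarrow> real" where
  "slope_deriv \<alpha> x = KI 0 \<alpha> x * KI 0 (\<alpha> - 1) x
     + x * ((KI 0 (\<alpha> - 1) x)\<^sup>2 - KI 0 \<alpha> x * KI 0 (\<alpha> - 2) x)"

lemma slope_has_real_derivative:
  assumes "x > 0"
  shows "((\<lambda>x. x * KI 0 (\<alpha> - 1) x / KI 0 \<alpha> x) has_real_derivative
           slope_deriv \<alpha> x / (KI 0 \<alpha> x)\<^sup>2) (at x)"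
proof -
  have "KI 0 \<alpha> x \<noteq> 0" using KI_pos'[OF assms, of \<alpha>] by simp
  then have "((\<lambda>x. x * KI 0 (\<alpha> - 1) x / KI 0 \<alpha> x) has_real_derivative
      ((1 * KI 0 (\<alpha> - 1) x + - KI 0 (\<alpha> - 1 - 1) x * x) * KI 0 \<alpha> x
       - x * KI 0 (\<alpha> - 1) x * - KI 0 (\<alpha> - 1) x) / (KI 0 \<alpha> x * KI 0 \<alpha> x)) (at x)"
    by (intro DERIV_divide DERIV_mult DERIV_ident KI_has_real_derivative assms)
  then show ?thesis
    by (simp add: slope_deriv_def power2_eq_square algebra_simps)
qed

lemma slope_deriv_nonneg_base:
  assumes "x > 0"
  shows "0 \<le> slope_deriv (-1) x"
proof -
  \<comment> \<open>\<open>?F\<close> is x times \<open>slope_deriv (-1)\<close> after Bessel's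
    equation has eliminated Ki_{-3}.\<close>
  let ?F = "\<lambda>x. (x * KI 0 (-2) x)\<^sup>2 - (x\<^sup>2 + 1) * (KI 0 (-1) x)\<^sup>2"
  have "0 \<le> ?F x"
  proof (rule nonneg_if_deriv_nonpos_tendsto_0[where f = ?F and x = x])
    fix y assume "x \<le> y"
    with assms have y: "y > 0" by simp
    let ?K = "KI 0 (-1) y" and ?K1 = "KI 0 (-2) y" and ?K2 = "KI 0 (-3) y"
    have "(?F has_real_derivative 2 * (y * ?K1) * (?K1 - y * ?K2) - 2 * y * ?K\<^sup>2 + 2 * (y\<^sup>2 + 1) * ?K * ?K1) (at y)"
      using KI_has_real_derivative[OF y, of 0 "-1"] KI_has_real_derivative[OF y, of 0 "-2"]
      by (auto intro!: derivative_eq_intros simp: power2_eq_square algebra_simps)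
    \<comment> \<open>Eliminating \<open>?K2\<close> through Bessel's equation cancels everything
      except the last square.\<close>
    moreover have "2 * (y * ?K1) * (?K1 - y * ?K2) - 2 * y * ?K\<^sup>2 + 2 * (y\<^sup>2 + 1) * ?K * ?K1 = - 2 * y * ?K\<^sup>2"
      using KI_bessel_equation[OF y] by algebra
    ultimately have "(?F has_real_derivative - 2 * y * ?K\<^sup>2) (at y)"
      by (simp only:)
    then show "\<exists>d. (?F has_real_derivative d) (at y) \<and> d \<le> 0"
      using y by (intro exI conjI) auto
  next
    have "((\<lambda>x. (x ^ 1 * KI 0 (-2) x)\<^sup>2 - ((x ^ 1 * KI 0 (-1) x)\<^sup>2 + (x ^ 0 * KI 0 (-1) x)\<^sup>2)) \<longlongrightarrow> 0\<^sup>2 - (0\<^sup>2 + 0\<^sup>2)) at_top"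
      by (intro tendsto_intros tendsto_power_times_KI)
    then show "(?F \<longlongrightarrow> 0) at_top"
      by (simp add: algebra_simps power_mult_distrib)
  qed
  also have "?F x = x * slope_deriv (-1) x"
    using KI_bessel_equation[OF assms] unfolding slope_deriv_def by (simp, algebra)
  finally show ?thesis
    using assms by (simp add: zero_le_mult_iff)
qed

text \<open>The derivative of the ratio is nonpositive by log-convexity in the order. The lemma
  keeps the ratio bounded on [1, \<infinity>), which the induction step uses for its limit.\<close>

lemma KI_ratio_antimono:
  assumes "0 < x" "x \<le> y"
  shows "KI 0 (\<alpha> - 1) y / KI 0 \<alpha> y \<le> KI 0 (\<alpha> - 1) x / KI 0 \<alpha> x"
proof (rule DERIV_nonpos_imp_nonincreasing[OF assms(2)])
  fix z assume "x \<le> z"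
  with assms have z: "z > 0" by simp
  let ?d = "((KI 0 (\<alpha> - 1) z)\<^sup>2 - KI 0 \<alpha> z * KI 0 (\<alpha> - 2) z) / (KI 0 \<alpha> z)\<^sup>2"
  have "KI 0 \<alpha> z \<noteq> 0" using KI_pos'[OF z, of \<alpha>] by simp
  then have "((\<lambda>z. KI 0 (\<alpha> - 1) z / KI 0 \<alpha> z) has_real_derivative
      (- KI 0 (\<alpha> - 1 - 1) z * KI 0 \<alpha> z - KI 0 (\<alpha> - 1) z * - KI 0 (\<alpha> - 1) z)
        / (KI 0 \<alpha> z * KI 0 \<alpha> z)) (at z)"
    by (intro DERIV_divide KI_has_real_derivative z)
  then have "((\<lambda>z. KI 0 (\<alpha> - 1) z / KI 0 \<alpha> z) has_real_derivative ?d) (at z)"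
    by (simp add: power2_eq_square algebra_simps)
  moreover have "?d \<le> 0"
    using KI_log_convex_order[OF z, of \<alpha>] by (intro divide_nonpos_nonneg) auto
  ultimately show "\<exists>d. ((\<lambda>z. KI 0 (\<alpha> - 1) z / KI 0 \<alpha> z) has_real_derivative d) (at z) \<and> d \<le> 0"
    by blast
qed

lemma slope_deriv_nonneg_step:
  assumes IH: "\<And>x. x > 0 \<Longrightarrow> 0 \<le> slope_deriv \<alpha> x" and x: "x > 0"
  shows "0 \<le> slope_deriv (\<alpha> + 1) x"
proof -
  let ?H = "KI 0 (\<alpha> + 1)" and ?h = "KI 0 \<alpha>" and ?g = "KI 0 (\<alpha> - 1)"
  define p where "p = (\<lambda>x. x * ?g x / ?h x)"
  let ?E = "\<lambda>x. ?H x + x * ?h x - ?H x * p x"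
  have "0 \<le> ?E x"
  proof (rule nonneg_if_deriv_nonpos_tendsto_0[where f = ?E and x = x])
    fix y assume "x \<le> y"
    with x have y: "y > 0" by simp
    have h: "?h y > 0" by (rule KI_pos'[OF y])
    have "(p has_real_derivative slope_deriv \<alpha> y / (?h y)\<^sup>2) (at y)"
      unfolding p_def by (rule slope_has_real_derivative[OF y])
    then have "(?E has_real_derivative - ?h y + (?h y - y * ?g y)
        - (- ?h y * p y + ?H y * (slope_deriv \<alpha> y / (?h y)\<^sup>2))) (at y)"
      using KI_has_real_derivative[OF y, of 0 \<alpha>] KI_has_real_derivative[OF y, of 0 "\<alpha> + 1"]
      by (auto intro!: derivative_eq_intros)
    \<comment> \<open>As h p = y g, all terms cancel except minus H times the derivative of p, which
      is nonnegative by the induction hypothesis.\<close>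
    moreover have "- ?h y + (?h y - y * ?g y)
        - (- ?h y * p y + ?H y * (slope_deriv \<alpha> y / (?h y)\<^sup>2)) \<le> 0"
      using h IH[OF y] KI_nonneg[of 0 "\<alpha> + 1" y] by (simp add: p_def)
    ultimately show "\<exists>d. (?E has_real_derivative d) (at y) \<and> d \<le> 0"
      by blast
  next
    \<comment> \<open>The value of the ratio at 1 bounds it on [1, \<infinity>), so H p is at most a
      constant times x H.\<close>
    let ?C = "?g 1 / ?h 1"
    have H: "((\<lambda>x. x ^ 1 * ?H x * ?C) \<longlongrightarrow> 0) at_top"
      by (intro tendsto_mult_left_zero tendsto_power_times_KI)
    have "((\<lambda>x. ?H x * p x) \<longlongrightarrow> 0) at_top"
    proof (rule Lim_null_comparison[OF _ H], rule eventually_at_top_linorderI[of 1])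
      fix y :: real assume y: "1 \<le> y"
      then have "norm (?H y * p y) = y * ?H y * (?g y / ?h y)"
        using KI_nonneg[of 0 "\<alpha> + 1" y] KI_nonneg[of 0 "\<alpha> - 1" y] KI_nonneg[of 0 \<alpha> y]
        by (simp add: p_def abs_mult abs_divide)
      also have "\<dots> \<le> y * ?H y * ?C"
        using y KI_nonneg[of 0 "\<alpha> + 1" y] by (intro mult_left_mono KI_ratio_antimono) auto
      finally show "norm (?H y * p y) \<le> y ^ 1 * ?H y * ?C"
        by simp
    qed
    then have "((\<lambda>x. x ^ 0 * ?H x + x ^ 1 * ?h x - ?H x * p x) \<longlongrightarrow> 0 + 0 - 0) at_top"
      by (intro tendsto_diff tendsto_add tendsto_power_times_KI)
    then show "(?E \<longlongrightarrow> 0) at_top"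
      by simp
  qed
  moreover have "slope_deriv (\<alpha> + 1) x = ?h x * ?E x"
    using KI_pos'[OF x, of \<alpha>] by (simp add: slope_deriv_def p_def field_simps power2_eq_square)
  ultimately show ?thesis
    using KI_nonneg[of 0 \<alpha> x] by simp
qed

lemma slope_deriv_nonneg:
  assumes "\<alpha> \<in> \<int>" "\<alpha> \<ge> -1" "x > 0"
  shows "0 \<le> slope_deriv \<alpha> x"
proof -
  \<comment> \<open>The shift by one starts the induction at order -1.\<close>
  have *: "0 \<le> slope_deriv (real n - 1) x" if "x > 0" for n x
    using that
  proof (induction n arbitrary: x)
    case 0
    then show ?case using slope_deriv_nonneg_base by simp
  next
    case (Suc n)
    then show ?case using slope_deriv_nonneg_step[of "real n - 1" x] by simp
  qed
  obtain k where k: "\<alpha> = of_int k"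
    using assms(1) by (elim Ints_cases)
  then have "\<alpha> = real (nat (k + 1)) - 1"
    using assms(2) by simp
  then show ?thesis
    using * assms(3) by metis
qed

text \<open>In the variable s = ln x the claim is ordinary convexity of -ln Ki, whose derivative is
  the slope p at exp s; p increases because \<open>slope_deriv\<close> is nonnegative.\<close>

lemma geometrically_concave_Ki:
  assumes \<alpha>: "\<alpha> \<in> \<int>" "\<alpha> \<ge> -1"
  shows "geometrically_concave (\<lambda>x. Ki \<alpha> x)"
proof -
  have cv: "convex_on UNIV (\<lambda>s. - ln (KI 0 \<alpha> (exp s)))"
  proof (rule convex_on_realI)
    fix s :: real
    have "KI 0 \<alpha> (exp s) > 0"
      by (simp add: KI_pos')
    then show "((\<lambda>s. - ln (KI 0 \<alpha> (exp s))) has_real_derivative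
          exp s * KI 0 (\<alpha> - 1) (exp s) / KI 0 \<alpha> (exp s)) (at s)"
      by (auto intro!: derivative_eq_intros DERIV_chain2[OF KI_has_real_derivative])
  next
    fix s t :: real assume "s \<le> t"
    then show "exp s * KI 0 (\<alpha> - 1) (exp s) / KI 0 \<alpha> (exp s) \<le> exp t * KI 0 (\<alpha> - 1) (exp t) / KI 0 \<alpha> (exp t)"
    proof (intro DERIV_nonneg_imp_nondecreasing[of "exp s" "exp t" "\<lambda>x. x * KI 0 (\<alpha> - 1) x / KI 0 \<alpha> x"])
      fix x assume "exp s \<le> x"
      then have x: "x > 0"
        using exp_gt_zero[of s] by linarith
      show "\<exists>d. ((\<lambda>x. x * KI 0 (\<alpha> - 1) x / KI 0 \<alpha> x) has_real_derivative d) (at x) \<and> 0 \<le> d"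
        using slope_has_real_derivative[OF x, of \<alpha>] slope_deriv_nonneg[OF \<alpha> x] by fastforce
    qed simp
  qed simp
  show ?thesis
    unfolding geometrically_concave_def
  proof (intro conjI allI impI ballI)
    show "0 < Ki \<alpha> x" if "x > 0" for x
      using that by (simp add: Ki_eq_KI KI_pos')
    fix x y c :: real assume x: "x > 0" and y: "y > 0" and c: "c \<in> {0..1}"
    \<comment> \<open>\<open>convex_onD\<close> puts its parameter on the second point, so the
      weight c of x is written as 1 - (1 - c).\<close>
    have e: "x powr c * y powr (1 - c) = exp ((1 - (1 - c)) *\<^sub>R ln x + (1 - c) *\<^sub>R ln y)"
      using x y by (simp add: powr_def exp_add)
    have p: "KI 0 \<alpha> x > 0" "KI 0 \<alpha> y > 0" "KI 0 \<alpha> (x powr c * y powr (1 - c)) > 0"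
      using x y by (auto intro: KI_pos')
    have "c * ln (KI 0 \<alpha> x) + (1 - c) * ln (KI 0 \<alpha> y) \<le> ln (KI 0 \<alpha> (x powr c * y powr (1 - c)))"
      using convex_onD[OF cv, of "1 - c" "ln x" "ln y"] c x y unfolding e[symmetric] by simp
    then have "exp (c * ln (KI 0 \<alpha> x) + (1 - c) * ln (KI 0 \<alpha> y)) \<le> KI 0 \<alpha> (x powr c * y powr (1 - c))"
      using p by (simp add: ln_ge_iff)
    then show "Ki \<alpha> x powr c * Ki \<alpha> y powr (1 - c) \<le> Ki \<alpha> (x powr c * y powr (1 - c))"
      using p by (simp add: Ki_eq_KI powr_def exp_add)
  qed
qed

section \<open>Complete monotonicity\<close>

text \<open>\<open>F m\<close> plays the role of (-1)^m times the m-th derivative. Openness of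
  \<open>I\<close> lets the derivative of \<open>F m\<close> pass to the iterate, which agrees with
  it only on \<open>I\<close>. The second conclusion later supplies the derivatives in x
  explicitly.\<close>

lemma completely_monotonic_onI:
  assumes I: "open I"
    and F0: "\<And>x. x \<in> I \<Longrightarrow> f x = F 0 x"
    and der: "\<And>m x. x \<in> I \<Longrightarrow> (F m has_real_derivative - F (Suc m) x) (at x)"
    and nonneg: "\<And>m x. x \<in> I \<Longrightarrow> 0 \<le> F m x"
  shows "completely_monotonic_on I f"
    and "\<And>m x. x \<in> I \<Longrightarrow> (deriv ^^ m) f x = (- 1) ^ m * F m x"
proof -
  have der': "((deriv ^^ m) f has_real_derivative (- 1) ^ Suc m * F (Suc m) x) (at x)"
    if eq: "\<And>x. x \<in> I \<Longrightarrow> (deriv ^^ m) f x = (- 1) ^ m * F m x" and x: "x \<in> I" for m x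
  proof (rule has_field_derivative_transform_within_open[OF _ I x])
    show "((\<lambda>x. (- 1) ^ m * F m x) has_real_derivative (- 1) ^ Suc m * F (Suc m) x) (at x)"
      using DERIV_cmult[OF der[OF x], of "(- 1) ^ m" m] by simp
  qed (simp add: eq)
  have eq: "(deriv ^^ m) f x = (- 1) ^ m * F m x" if "x \<in> I" for m x
    using that
  proof (induction m arbitrary: x)
    case 0
    then show ?case by (simp add: F0)
  next
    case (Suc m)
    then show ?case using DERIV_imp_deriv[OF der'[of m x]] by simp
  qed
  then show "(deriv ^^ m) f x = (- 1) ^ m * F m x" if "x \<in> I" for m x
    using that by blast
  have "(- 1) ^ m * ((- 1) ^ m * F m x) = F m x" for m x
    by (simp flip: mult.assoc power_mult_distrib)
  then show "completely_monotonic_on I f"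
    unfolding completely_monotonic_on_def
    using eq nonneg der'[OF eq] unfolding real_differentiable_def by (metis (no_types))
qed

lemma KI_derivative_chain:
  assumes "x \<in> {0<..}"
  shows "(KI 0 (\<alpha> - real m) has_real_derivative - KI 0 (\<alpha> - real (Suc m)) x) (at x)"
proof -
  have eq: "\<alpha> - real (Suc m) = \<alpha> - real m - 1" by simp
  show ?thesis
    unfolding eq using assms by (intro KI_has_real_derivative) simp
qed

lemma completely_monotonic_on_Ki_argument: "completely_monotonic_on {0<..} (\<lambda>x. Ki \<alpha> x)"
  by (rule completely_monotonic_onI(1)[where F = "\<lambda>m. KI 0 (\<alpha> - real m)"])
     (auto simp: Ki_eq_KI KI_nonneg simp del: of_nat_Suc intro!: KI_derivative_chain)

lemma completely_monotonic_on_Ki_order: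
  "x > 0 \<Longrightarrow> completely_monotonic_on UNIV (\<lambda>\<alpha>. Ki \<alpha> x)"
  by (rule completely_monotonic_onI(1)[where F = "\<lambda>m \<alpha>. KI m \<alpha> x"])
     (auto simp: Ki_eq_KI KI_nonneg intro!: KI_has_real_derivative_order)

lemma higher_deriv_Ki:
  assumes "x > 0"
  shows "(deriv ^^ m) (Ki \<alpha>) x = (- 1) ^ m * Ki (\<alpha> - real m) x"
  using completely_monotonic_onI(2)[of "{0<..}" "Ki \<alpha>" "\<lambda>m. KI 0 (\<alpha> - real m)" x m] assms
  by (auto simp: Ki_eq_KI KI_nonneg simp del: of_nat_Suc intro!: KI_derivative_chain)

section \<open>Monotonicity, mean values, Turan and product inequalities\<close>

lemma Ki_pos: "x > 0 \<Longrightarrow> 0 < Ki \<alpha> x"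
  by (simp add: Ki_eq_KI KI_pos')

lemma Ki_antimono_order:
  assumes "x > 0" "\<alpha> \<le> \<beta>"
  shows "Ki \<beta> x \<le> Ki \<alpha> x"
  unfolding Ki_eq_KI KI_def using assms
  by (intro integral_mono integrable_kernel kernel_antimono) auto

lemma Ki_antimono_argument:
  assumes "x > 0" "x \<le> y"
  shows "Ki \<alpha> y \<le> Ki \<alpha> x"
  unfolding Ki_eq_KI KI_def using assms
  by (intro integral_mono integrable_kernel kernel_antimono) auto

lemma log_convex_on_midpoint:
  assumes "log_convex_on S h" "u \<in> S" "v \<in> S"
  shows "(h ((1/2) *\<^sub>R u + (1/2) *\<^sub>R v))\<^sup>2 \<le> h u * h v"
  using log_convex_on_majorization[OF assms, of "1/2"] by (simp add: power2_eq_square)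

lemma Ki_turan_symmetric:
  assumes "x > 0"
  shows "(Ki \<alpha> x)\<^sup>2 \<le> Ki (\<alpha> + \<nu>) x * Ki (\<alpha> - \<nu>) x"
proof -
  have "(1/2) *\<^sub>R (\<alpha> + \<nu>) + (1/2) *\<^sub>R (\<alpha> - \<nu>) = \<alpha>"
    by (simp add: field_simps)
  with log_convex_on_midpoint[OF log_convex_on_Ki_order[OF assms], of "\<alpha> + \<nu>" "\<alpha> - \<nu>"]
  show ?thesis
    by (simp only: UNIV_I)
qed

lemma Ki_arithmetic_mean_le:
  assumes "x > 0" "y > 0"
  shows "Ki \<alpha> ((x + y) / 2) \<le> sqrt (Ki \<alpha> x * Ki \<alpha> y)"
  using log_convex_on_midpoint[OF log_convex_on_Ki_argument, of x y \<alpha>] assms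
  by (intro real_le_rsqrt) (simp add: add_divide_distrib)

lemma Ki_geometric_mean_ge:
  assumes "\<alpha> \<in> \<int>" "\<alpha> \<ge> -1" "x > 0" "y > 0"
  shows "sqrt (Ki \<alpha> x * Ki \<alpha> y) \<le> Ki \<alpha> (sqrt (x * y))"
proof -
  have "Ki \<alpha> x powr (1/2) * Ki \<alpha> y powr (1 - 1/2) \<le> Ki \<alpha> (x powr (1/2) * y powr (1 - 1/2))"
    using geometrically_concave_Ki[OF assms(1,2)] assms(3,4)
    unfolding geometrically_concave_def by (elim conjE allE[of _ x] allE[of _ y] impE ballE[of _ _ "1/2"]) auto
  then show ?thesis
    using assms Ki_pos[of x \<alpha>] Ki_pos[of y \<alpha>] by (simp add: powr_half_sqrt real_sqrt_mult)
qed

lemma Ki_turan_lower: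
  assumes "x > 0"
  shows "1 \<le> Ki \<alpha> x * Ki (\<alpha> - 2) x / (Ki (\<alpha> - 1) x)\<^sup>2"
  using KI_log_convex_order[OF assms, of \<alpha>] Ki_pos[OF assms, of "\<alpha> - 1"]
  by (simp add: Ki_eq_KI)

text \<open>Nonnegativity of \<open>slope_deriv\<close>, divided by x times the square of
  Ki_{\<alpha>-1}(x).\<close>

lemma Ki_turan_upper:
  assumes "\<alpha> \<in> \<int>" "\<alpha> \<ge> -1" "x > 0"
  shows "Ki \<alpha> x * Ki (\<alpha> - 2) x / (Ki (\<alpha> - 1) x)\<^sup>2 \<le> 1 + Ki \<alpha> x / (x * Ki (\<alpha> - 1) x)"
proof -
  have g: "Ki (\<alpha> - 1) x > 0"
    by (rule Ki_pos) fact
  have "x * (Ki \<alpha> x * Ki (\<alpha> - 2) x) \<le> x * (Ki (\<alpha> - 1) x)\<^sup>2 + Ki \<alpha> x * Ki (\<alpha> - 1) x"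
    using slope_deriv_nonneg[OF assms] by (simp add: slope_deriv_def Ki_eq_KI algebra_simps)
  also have "\<dots> = (1 + Ki \<alpha> x / (x * Ki (\<alpha> - 1) x)) * (x * (Ki (\<alpha> - 1) x)\<^sup>2)"
    using g assms(3) by (simp add: field_simps power2_eq_square)
  finally have "x * (Ki \<alpha> x * Ki (\<alpha> - 2) x) / (x * (Ki (\<alpha> - 1) x)\<^sup>2) \<le> 1 + Ki \<alpha> x / (x * Ki (\<alpha> - 1) x)"
    using g assms(3) by (simp add: pos_divide_le_eq)
  then show ?thesis
    using assms(3) by simp
qed

lemma Ki_majorization_order:
  assumes "x > 0" "a \<le> c" "c \<le> b" "c + d = a + b"
  shows "Ki c x * Ki d x \<le> Ki a x * Ki b x"
  using log_convex_on_majorization_real[OF log_convex_on_Ki_order[OF assms(1)], of a b c d] assms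
  by simp

text \<open>Both pairs of orders sum to \<alpha>, and either sign condition puts -\<beta> between 0
  and \<alpha>, so 0 and \<alpha> form the outer pair.\<close>

lemma Ki_product_le:
  assumes "x > 0" "(\<alpha> + \<beta> \<le> 0 \<and> 0 \<le> \<beta>) \<or> (\<alpha> + \<beta> \<ge> 0 \<and> 0 \<ge> \<beta>)"
  shows "Ki (- \<beta>) x * Ki (\<alpha> + \<beta>) x \<le> Ki 0 x * Ki \<alpha> x"
  using assms Ki_majorization_order[of x \<alpha> "- \<beta>" 0 "\<alpha> + \<beta>"] Ki_majorization_order[of x 0 "- \<beta>" \<alpha> "\<alpha> + \<beta>"]
  by (auto simp: mult.commute)

text \<open>Now 0 lies between -\<beta> and \<alpha> + \<beta>, so inner and outer pair change
  places.\<close>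

lemma Ki_product_ge:
  assumes "x > 0" "(\<beta> \<ge> 0 \<and> \<alpha> + \<beta> \<ge> 0) \<or> (\<beta> \<le> 0 \<and> \<alpha> + \<beta> \<le> 0)"
  shows "Ki 0 x * Ki \<alpha> x \<le> Ki (- \<beta>) x * Ki (\<alpha> + \<beta>) x"
  using assms Ki_majorization_order[of x "- \<beta>" 0 "\<alpha> + \<beta>" \<alpha>] Ki_majorization_order[of x "\<alpha> + \<beta>" 0 "- \<beta>" \<alpha>]
  by (auto simp: mult.commute)

section \<open>Relative convexity\<close>

lemma deriv_ratio_Ki:
  assumes "x > 0"
  shows "deriv (deriv (Ki \<alpha>)) x / deriv (Ki \<alpha>) x = - (Ki (\<alpha> - 2) x / Ki (\<alpha> - 1) x)"
  using higher_deriv_Ki[OF assms, of 1 \<alpha>] higher_deriv_Ki[OF assms, of 2 \<alpha>]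
  by (simp add: numeral_2_eq_2)

lemma Ki_ratio_le:
  assumes "\<alpha> \<ge> 2" "x > 0"
  shows "Ki (\<alpha> - 2) x * Ki 1 x \<le> Ki 0 x * Ki (\<alpha> - 1) x"
  using Ki_majorization_order[OF assms(2), of 0 "\<alpha> - 2" "\<alpha> - 1" 1] assms(1) by simp

lemma Ki_has_real_derivative:
  assumes "x > 0"
  shows "(Ki \<alpha> has_real_derivative - Ki (\<alpha> - 1) x) (at x)"
  using KI_has_real_derivative[OF assms] by (simp add: Ki_eq_KI)

text \<open>The ratio is the slope of -Ki_\<alpha> as a function of -Ki_2. The numerator of its
  derivative is nonnegative by \<open>Ki_ratio_le\<close>.\<close>

lemma Ki_slope_ratio_mono:
  assumes "\<alpha> \<ge> 2" "0 < x" "x \<le> y"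
  shows "Ki (\<alpha> - 1) x / Ki 1 x \<le> Ki (\<alpha> - 1) y / Ki 1 y"
proof (rule DERIV_nonneg_imp_nondecreasing[OF assms(3)])
  fix z assume "x \<le> z"
  with assms have z: "z > 0" by simp
  let ?d = "(- Ki (\<alpha> - 1 - 1) z * Ki 1 z - Ki (\<alpha> - 1) z * - Ki (1 - 1) z) / (Ki 1 z * Ki 1 z)"
  have "((\<lambda>z. Ki (\<alpha> - 1) z / Ki 1 z) has_real_derivative ?d) (at z)"
    using Ki_pos[OF z, of 1] by (intro DERIV_divide Ki_has_real_derivative z) simp
  moreover have "?d \<ge> 0"
    using Ki_ratio_le[OF assms(1) z] by (intro divide_nonneg_nonneg) (simp_all add: mult.commute)
  ultimately show "\<exists>d. ((\<lambda>z. Ki (\<alpha> - 1) z / Ki 1 z) has_real_derivative d) (at z) \<and> 0 \<le> d"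
    by blast
qed

text \<open>The left side is the tangent at z of -Ki_\<alpha> as a function of -Ki_2. The gap
  between curve and tangent has derivative Ki_1(y) times the slope at y minus the slope at z, so it
  is least at z. Working in x avoids differentiating the inverse function.\<close>

lemma Ki_supporting_line:
  assumes "\<alpha> \<ge> 2" "x > 0" "z > 0"
  shows "- Ki \<alpha> z + Ki (\<alpha> - 1) z / Ki 1 z * (Ki 2 z - Ki 2 x) \<le> - Ki \<alpha> x"
proof -
  define m where "m = Ki (\<alpha> - 1) z / Ki 1 z"
  let ?g = "\<lambda>y. m * Ki 2 y - Ki \<alpha> y"
  let ?d = "\<lambda>y. Ki 1 y * (Ki (\<alpha> - 1) y / Ki 1 y - m)"
  have der: "(?g has_real_derivative ?d y) (at y)" if "y > 0" for y
  proof -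
    have "(?g has_real_derivative m * - Ki (2 - 1) y - - Ki (\<alpha> - 1) y) (at y)"
      by (intro DERIV_diff DERIV_cmult Ki_has_real_derivative that)
    moreover have "m * - Ki (2 - 1) y - - Ki (\<alpha> - 1) y = ?d y"
      using Ki_pos[OF that, of 1] by (simp add: right_diff_distrib)
    ultimately show ?thesis
      by simp
  qed
  have "?g z \<le> ?g x"
  proof (cases "z \<le> x")
    case True
    then show ?thesis
    proof (rule DERIV_nonneg_imp_nondecreasing)
      fix y assume y: "z \<le> y"
      then have "0 \<le> ?d y"
        using Ki_slope_ratio_mono[OF assms(1,3) y] Ki_pos[of y 1] assms(3)
        by (intro mult_nonneg_nonneg) (auto simp: m_def)
      then show "\<exists>d. (?g has_real_derivative d) (at y) \<and> 0 \<le> d"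
        using der[of y] y assms(3) by (intro exI[of _ "?d y"]) auto
    qed
  next
    case False
    then have "x \<le> z" by simp
    then show ?thesis
    proof (rule DERIV_nonpos_imp_nonincreasing)
      fix y assume y: "x \<le> y" "y \<le> z"
      then have "?d y \<le> 0"
        using Ki_slope_ratio_mono[OF assms(1) _ y(2)] Ki_pos[of y 1] assms(2)
        by (intro mult_nonneg_nonpos) (auto simp: m_def)
      then show "\<exists>d. (?g has_real_derivative d) (at y) \<and> d \<le> 0"
        using der[of y] y assms(2) by (intro exI[of _ "?d y"]) auto
    qed
  qed
  then show ?thesis
    by (simp add: m_def right_diff_distrib)
qed

lemma continuous_on_Ki: "continuous_on {0<..} (Ki \<alpha>)"
  using Ki_has_real_derivative
  by (intro continuous_at_imp_continuous_on ballI DERIV_isCont) auto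

lemma Ki_strict_antimono:
  assumes "0 < x" "x < y"
  shows "Ki \<alpha> y < Ki \<alpha> x"
proof (rule DERIV_neg_imp_decreasing[OF assms(2)])
  fix z assume "x \<le> z"
  with assms have z: "z > 0" by simp
  show "\<exists>d. (Ki \<alpha> has_real_derivative d) (at z) \<and> d < 0"
    using Ki_has_real_derivative[OF z] Ki_pos[OF z, of "\<alpha> - 1"] by (intro exI conjI) auto
qed

lemma convex_on_wrt_Ki:
  assumes "\<alpha> \<ge> 2"
  shows "convex_on_wrt {0<..} (\<lambda>x. - Ki \<alpha> x) (\<lambda>x. - Ki 2 x)"
proof -
  let ?\<psi> = "\<lambda>x. - Ki 2 x"
  have mono: "strict_mono_on {0<..} ?\<psi>"
    by (auto simp: strict_mono_on_def intro: Ki_strict_antimono)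
  have inv: "inv_into {0<..} ?\<psi> (?\<psi> x) = x" if "x > 0" for x
    using that strict_mono_on_imp_inj_on[OF mono] by (intro inv_into_f_f) auto
  have cont: "continuous_on {0<..} ?\<psi>"
    by (intro continuous_intros continuous_on_Ki)
  then have cvx: "convex (?\<psi> ` {0<..})"
    using connected_continuous_image[OF cont] by (simp add: convex_real_interval flip: is_interval_connected_1 is_interval_convex_1)
  have "convex_on (?\<psi> ` {0<..}) ((\<lambda>x. - Ki \<alpha> x) \<circ> inv_into {0<..} ?\<psi>)"
  proof (rule convex_onI[OF _ cvx])
    fix t a b :: real
    assume t: "0 < t" "t < 1" and a: "a \<in> ?\<psi> ` {0<..}" and b: "b \<in> ?\<psi> ` {0<..}"
    then obtain x y where xy: "x > 0" "a = ?\<psi> x" "y > 0" "b = ?\<psi> y"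
      by auto
    have "(1 - t) *\<^sub>R a + t *\<^sub>R b \<in> ?\<psi> ` {0<..}"
      using cvx a b t by (intro convexD) auto
    then obtain z where z: "z > 0" "(1 - t) *\<^sub>R a + t *\<^sub>R b = ?\<psi> z"
      by auto
    define m where "m = Ki (\<alpha> - 1) z / Ki 1 z"
    \<comment> \<open>-Ki_2(z) is the convex combination of the values at x and y, so the two slope
      terms cancel; averaging the supporting-line bounds then gives convexity.\<close>
    have "- Ki \<alpha> z = (1 - t) * (- Ki \<alpha> z + m * (Ki 2 z - Ki 2 x)) + t * (- Ki \<alpha> z + m * (Ki 2 z - Ki 2 y))"
      using z(2) unfolding xy by (simp, algebra)
    also have "\<dots> \<le> (1 - t) * - Ki \<alpha> x + t * - Ki \<alpha> y"
      using Ki_supporting_line[OF assms _ z(1)] xy t unfolding m_def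
      by (intro add_mono mult_left_mono) auto
    finally show "((\<lambda>x. - Ki \<alpha> x) \<circ> inv_into {0<..} ?\<psi>) ((1 - t) *\<^sub>R a + t *\<^sub>R b)
        \<le> (1 - t) * ((\<lambda>x. - Ki \<alpha> x) \<circ> inv_into {0<..} ?\<psi>) a
           + t * ((\<lambda>x. - Ki \<alpha> x) \<circ> inv_into {0<..} ?\<psi>) b"
      unfolding z(2) using inv xy z(1) by simp
  qed
  then show ?thesis
    unfolding convex_on_wrt_def using mono cont continuous_on_Ki
    by (auto intro!: continuous_intros simp: is_interval_convex_1)
qed

section \<open>The quarter bound of Gruess type\<close>

text \<open>The difference is nonnegative by \<open>Ki_product_le\<close>. If a is the smaller
  factor of the subtracted product, then Ki_\<alpha> is at most a, and the difference is at most
  Ki_0 a - a^2, whose maximum over a is Ki_0^2 / 4.\<close>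

lemma Ki_gruess:
  assumes "\<alpha> + \<beta> \<ge> 0" "\<beta> \<le> 0" "x > 0"
  shows "\<bar>Ki 0 x * Ki \<alpha> x - Ki (- \<beta>) x * Ki (\<alpha> + \<beta>) x\<bar> \<le> (Ki 0 x)\<^sup>2 / 4"
proof -
  have le: "Ki (- \<beta>) x * Ki (\<alpha> + \<beta>) x \<le> Ki 0 x * Ki \<alpha> x"
    using assms by (intro Ki_product_le) auto
  have *: "Ki 0 x * c - a * b \<le> (Ki 0 x)\<^sup>2 / 4"
    if "c \<le> a" "a \<le> b" "0 \<le> a" for a b c
  proof -
    have "Ki 0 x * c \<le> Ki 0 x * a" "a * a \<le> a * b"
      using that Ki_pos[OF assms(3), of 0] by (auto intro: mult_left_mono)
    moreover have "0 \<le> (a - Ki 0 x / 2)\<^sup>2"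
      by simp
    ultimately show ?thesis
      by (simp add: power2_eq_square field_simps)
  qed
  have "Ki \<alpha> x \<le> Ki (- \<beta>) x" "Ki \<alpha> x \<le> Ki (\<alpha> + \<beta>) x"
    using assms by (auto intro: Ki_antimono_order)
  then have "Ki 0 x * Ki \<alpha> x - Ki (- \<beta>) x * Ki (\<alpha> + \<beta>) x \<le> (Ki 0 x)\<^sup>2 / 4"
    using *[of "Ki \<alpha> x" "Ki (- \<beta>) x" "Ki (\<alpha> + \<beta>) x"] *[of "Ki \<alpha> x" "Ki (\<alpha> + \<beta>) x" "Ki (- \<beta>) x"]
      Ki_pos[OF assms(3), of "- \<beta>"] Ki_pos[OF assms(3), of "\<alpha> + \<beta>"]
    by (cases "Ki (- \<beta>) x \<le> Ki (\<alpha> + \<beta>) x") (auto simp: mult.commute)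
  with le show ?thesis
    by simp
qed

section \<open>The value at zero\<close>

lemma Ki_0_eq_Gamma:
  assumes "\<alpha> > 0"
  shows "Ki \<alpha> 0 = sqrt pi * Gamma (\<alpha> / 2) / (2 * Gamma ((\<alpha> + 1) / 2))"
proof -
  \<comment> \<open>The open half-line is used because the substitution is a bijection from there
    onto (0, 1).\<close>
  let ?g = "\<lambda>t::real. 1 / (cosh t)\<^sup>2" and ?g' = "\<lambda>t::real. - 2 * sinh t / cosh t ^ 3"
  let ?f = "\<lambda>u::real. u powr (\<alpha> / 2 - 1) * (1 - u) powr (1 / 2 - 1)"
  have "(?f has_integral Beta (\<alpha> / 2) (1 / 2)) {0<..<1}"
    using has_integral_Beta_real[of "\<alpha> / 2" "1 / 2"] assms by (simp add: has_integral_Icc_iff_Ioo)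
  then have f: "?f absolutely_integrable_on {0<..<1}" "integral {0<..<1} ?f = Beta (\<alpha> / 2) (1 / 2)"
    by (auto intro!: nonnegative_absolutely_integrable_1 simp: has_integral_iff)
  have img: "?g ` {0<..} = {0<..<1}"
  proof (intro equalityI subsetI)
    fix u assume "u \<in> ?g ` {0<..}"
    then obtain t where t: "t > 0" "u = ?g t" by auto
    then have "cosh t > 1"
      using cosh_real_nonneg_less_iff[of 0 t] by simp
    then show "u \<in> {0<..<1}"
      using t by (simp add: one_less_power)
  next
    fix u :: real assume u: "u \<in> {0<..<1}"
    then have s: "1 / sqrt u > 1"
      by simp
    have "u = ?g (arcosh (1 / sqrt u))"
      using u s by (simp add: cosh_arcosh_real power_divide)
    moreover have "arcosh (1 / sqrt u) > 0"
      using s arcosh_real_strict_mono[of 1 "1 / sqrt u"] by simp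
    ultimately show "u \<in> ?g ` {0<..}"
      by blast
  qed
  have inj: "inj_on ?g {0<..}"
    by (rule inj_onI) (auto simp: power2_eq_iff_nonneg)
  have int: "\<bar>?g' t\<bar> * ?f (?g t) = 2 * kernel 0 \<alpha> 0 t" if "t > 0" for t
  proof -
    define c s where "c = cosh t" and "s = sinh t"
    have c: "c > 0" and s: "s > 0" and cs: "c\<^sup>2 = s\<^sup>2 + 1"
      using that by (auto simp: c_def s_def cosh_square_eq)
    \<comment> \<open>1 - u is the square of tanh t, so its power -1/2 is c / s; this cancels the
      sinh in the Jacobian.\<close>
    have "1 - 1 / c\<^sup>2 = (s / c)\<^sup>2"
    proof -
      have "s\<^sup>2 = c\<^sup>2 - 1"
        using cs by simp
      then show ?thesis
        using c by (simp add: power_divide diff_divide_distrib)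
    qed
    also have "\<dots> powr (1 / 2 - 1) = c / s"
    proof -
      have "(s / c)\<^sup>2 powr (1 / 2 - 1) = ((s / c) powr 2) powr (- (1 / 2))"
        using c s by (simp add: powr_numeral)
      also have "\<dots> = (s / c) powr - 1"
        by (simp only: powr_powr) simp
      also have "\<dots> = c / s"
        using c s by (simp add: powr_minus_divide)
      finally show ?thesis .
    qed
    finally have 1: "(1 - 1 / c\<^sup>2) powr (1 / 2 - 1) = c / s" .
    have "(1 / c\<^sup>2) powr (\<alpha> / 2 - 1) = (c powr - 2) powr (\<alpha> / 2 - 1)"
      using c by (simp add: powr_minus_divide powr_numeral)
    also have "\<dots> = c powr (- \<alpha> + 2)"
      by (simp add: powr_powr algebra_simps)
    also have "\<dots> = c powr (- \<alpha>) * c\<^sup>2"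
      unfolding powr_add using c by (simp add: powr_numeral)
    finally have 2: "(1 / c\<^sup>2) powr (\<alpha> / 2 - 1) = c powr (- \<alpha>) * c\<^sup>2" .
    have "\<bar>- 2 * s / c ^ 3\<bar> * (c powr (- \<alpha>) * c\<^sup>2 * (c / s)) = 2 * c powr (- \<alpha>)"
      using c s by (simp add: abs_mult abs_divide power2_eq_square power3_eq_cube)
    then show ?thesis
      unfolding c_def[symmetric] s_def[symmetric] 1 2 kernel_0_powr by (simp add: c_def)
  qed
  have der: "(?g has_real_derivative ?g' t) (at t within {0<..})" for t
    by (auto intro!: derivative_eq_intros simp: power2_eq_square power3_eq_cube)
  have "integral {0<..} (\<lambda>t. \<bar>?g' t\<bar> * ?f (?g t)) = Beta (\<alpha> / 2) (1 / 2)"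
    using has_absolute_integral_change_of_variables_1'[of "{0<..}" ?g ?g' ?f "Beta (\<alpha> / 2) (1 / 2)", OF _ der inj] f
    unfolding img by simp
  then have "Beta (\<alpha> / 2) (1 / 2) = integral {0<..} (\<lambda>t. 2 * kernel 0 \<alpha> 0 t)"
    using Henstock_Kurzweil_Integration.integral_cong[of "{0<..}" "\<lambda>t. \<bar>?g' t\<bar> * ?f (?g t)" "\<lambda>t. 2 * kernel 0 \<alpha> 0 t"] int
    by simp
  also have "\<dots> = integral {0..} (\<lambda>t. 2 * kernel 0 \<alpha> 0 t)"
    by (rule integral_spike_set) (auto intro: negligible_subset[of "{0}"])
  also have "\<dots> = (LINT t:{0..}|lborel. 2 * kernel 0 \<alpha> 0 t)"
    unfolding set_integrable_def
    by (intro set_borel_integral_eq_integral(2)[symmetric, unfolded set_integrable_def]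
          iffD1[OF integrable_restrict_space] integrable_mult_right integrable_kernel_0 assms) simp
  also have "\<dots> = 2 * Ki \<alpha> 0"
    by (simp add: Ki_def kernel_0_powr)
  finally show ?thesis
    by (simp add: Beta_def Gamma_one_half_real add_divide_distrib mult.commute)
qed

lemma Ki_0_pos: "\<alpha> > 0 \<Longrightarrow> 0 < Ki \<alpha> 0"
  by (simp add: Ki_eq_KI KI_pos Ki_domain_def)

lemma Ki_supermultiplicative:
  assumes "\<alpha> > 0" "x > 0" "y > 0"
  shows "Ki \<alpha> x * Ki \<alpha> y \<le> Ki \<alpha> 0 * Ki \<alpha> (x + y)"
  using log_convex_on_majorization_real[OF log_convex_on_Ki_argument_0[OF assms(1)], of 0 "x + y" x y] assms
  by simp

text \<open>Bernoulli's inequality reduces both terms to weight 1, and then the product of 1 - exp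
  (-ra) and 1 - exp (-sb) is nonnegative.\<close>

lemma exp_neg_weighted_le:
  fixes a b r s :: real
  assumes "a \<ge> 0" "b \<ge> 0" "r \<ge> 1" "s \<ge> 1"
  shows "r * exp (- a) + s * exp (- b) \<le> exp (- (r * a + s * b)) + (r + s - 1)"
proof -
  have bernoulli: "r * exp (- a) \<le> exp (- (r * a)) + (r - 1)" if "r \<ge> 1" for r a :: real
  proof -
    \<comment> \<open>-a is the convex combination of 0 and -ra with weight 1 / r on the
      latter.\<close>
    have "exp ((1 - 1 / r) *\<^sub>R 0 + (1 / r) *\<^sub>R (- (r * a))) \<le> (1 - 1 / r) * exp 0 + (1 / r) * exp (- (r * a))"
      using that by (intro convex_onD[OF exp_convex]) auto
    then have "exp (- a) \<le> (1 - 1 / r) + exp (- (r * a)) / r"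
      using that by simp
    then have "r * exp (- a) \<le> r * ((1 - 1 / r) + exp (- (r * a)) / r)"
      using that by (intro mult_left_mono) auto
    then show ?thesis
      using that by (simp add: distrib_left right_diff_distrib)
  qed
  have "0 \<le> (1 - exp (- (r * a))) * (1 - exp (- (s * b)))"
    using assms by (intro mult_nonneg_nonneg) auto
  then have "exp (- (r * a)) + exp (- (s * b)) \<le> exp (- (r * a + s * b)) + 1"
    by (simp add: algebra_simps exp_add[symmetric])
  then show ?thesis
    using bernoulli[OF assms(3), of a] bernoulli[OF assms(4), of b] by simp
qed

text \<open>The pointwise inequality is integrated against the power of cosh t; its constant term
  produces the value at 0.\<close>

lemma Ki_weighted_sum_le:
  assumes "r \<ge> 1" "s \<ge> 1" "\<alpha> > 0" "x > 0" "y > 0"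
  shows "r * Ki \<alpha> x + s * Ki \<alpha> y \<le> Ki \<alpha> (r * x + s * y) + (r + s - 1) * Ki \<alpha> 0"
proof -
  have z: "r * x + s * y > 0"
    using assms by (intro add_pos_pos mult_pos_pos) auto
  note int = integrable_kernel[OF assms(4), of 0 \<alpha>] integrable_kernel[OF assms(5), of 0 \<alpha>]
    integrable_kernel[OF z, of 0 \<alpha>] integrable_kernel_0[OF assms(3)]
  have "(LINT t|half_line. r * kernel 0 \<alpha> x t + s * kernel 0 \<alpha> y t)
      \<le> (LINT t|half_line. kernel 0 \<alpha> (r * x + s * y) t + (r + s - 1) * kernel 0 \<alpha> 0 t)"
  proof (rule integral_mono)
    fix t
    have "(r * exp (- (x * cosh t)) + s * exp (- (y * cosh t))) * cosh t powr (- \<alpha>)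
        \<le> (exp (- (r * (x * cosh t) + s * (y * cosh t))) + (r + s - 1)) * cosh t powr (- \<alpha>)"
      using assms by (intro mult_right_mono exp_neg_weighted_le) auto
    then show "r * kernel 0 \<alpha> x t + s * kernel 0 \<alpha> y t
        \<le> kernel 0 \<alpha> (r * x + s * y) t + (r + s - 1) * kernel 0 \<alpha> 0 t"
      unfolding kernel_0_powr by (simp add: algebra_simps)
  qed (use int in auto)
  then show ?thesis
    using int by (simp add: Ki_eq_KI KI_def)
qed

text \<open>Pointwise, both powers of cosh t are at most 1, so the product of their complements to 1
  is nonnegative.\<close>

lemma Ki_order_sum_le:
  assumes "\<alpha> > 0" "\<beta> > 0" "x > 0"
  shows "Ki \<alpha> x + Ki \<beta> x \<le> Ki 0 x + Ki (\<alpha> + \<beta>) x"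
proof -
  note int = integrable_kernel[OF assms(3), of 0]
  have "(LINT t|half_line. kernel 0 \<alpha> x t + kernel 0 \<beta> x t)
      \<le> (LINT t|half_line. kernel 0 0 x t + kernel 0 (\<alpha> + \<beta>) x t)"
  proof (rule integral_mono)
    fix t
    have "cosh t powr (- \<alpha>) \<le> 1" "cosh t powr (- \<beta>) \<le> 1"
      using powr_mono[of "- \<alpha>" 0 "cosh t"] powr_mono[of "- \<beta>" 0 "cosh t"] assms cosh_real_ge_1[of t]
      by auto
    then have "0 \<le> exp (- x * cosh t) * ((1 - cosh t powr (- \<alpha>)) * (1 - cosh t powr (- \<beta>)))"
      by (intro mult_nonneg_nonneg) auto
    moreover have "cosh t powr (- (\<alpha> + \<beta>)) = cosh t powr (- \<alpha>) * cosh t powr (- \<beta>)"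
      by (simp flip: powr_add)
    ultimately show "kernel 0 \<alpha> x t + kernel 0 \<beta> x t \<le> kernel 0 0 x t + kernel 0 (\<alpha> + \<beta>) x t"
      by (simp add: kernel_0_powr algebra_simps)
  qed (use int in auto)
  then show ?thesis
    using int by (simp add: Ki_eq_KI KI_def)
qed

lemma Ki_order_supermultiplicative:
  assumes "\<alpha> > 0" "\<beta> > 0" "x > 0"
  shows "1 / Ki 0 x * Ki \<alpha> x * Ki \<beta> x \<le> Ki (\<alpha> + \<beta>) x"
  using Ki_majorization_order[OF assms(3), of 0 \<alpha> "\<alpha> + \<beta>" \<beta>] assms Ki_pos[OF assms(3), of 0]
  by (simp add: field_simps)

lemma Ki_order_midpoint:
  assumes "x > 0"
  shows "2 * Ki \<alpha> x \<le> Ki (\<alpha> + \<beta>) x + Ki (\<alpha> - \<beta>) x"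
proof (rule power2_le_imp_le)
  have "4 * (Ki \<alpha> x)\<^sup>2 \<le> 4 * (Ki (\<alpha> + \<beta>) x * Ki (\<alpha> - \<beta>) x)"
    using Ki_turan_symmetric[OF assms] by simp
  also have "\<dots> \<le> (Ki (\<alpha> + \<beta>) x + Ki (\<alpha> - \<beta>) x)\<^sup>2"
    using zero_le_power2[of "Ki (\<alpha> + \<beta>) x - Ki (\<alpha> - \<beta>) x"]
    by (simp add: power2_eq_square algebra_simps)
  finally show "(2 * Ki \<alpha> x)\<^sup>2 \<le> (Ki (\<alpha> + \<beta>) x + Ki (\<alpha> - \<beta>) x)\<^sup>2"
    by (simp add: power_mult_distrib)
qed (use Ki_pos[OF assms] less_imp_le in \<open>auto intro!: add_nonneg_nonneg\<close>)

text \<open>The symmetric Turan inequalities for shifts \<nu> and \<mu>, multiplied and regrouped,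
  bound the fourth power of Ki_\<alpha> by \<open>?p * ?q\<close>; the arithmetic-geometric mean
  inequality finishes.\<close>

lemma Ki_order_double_midpoint:
  assumes "x > 0"
  shows "2 * (Ki \<alpha> x)\<^sup>2
    \<le> Ki (\<alpha> + \<nu>) x * Ki (\<alpha> - \<mu>) x + Ki (\<alpha> - \<nu>) x * Ki (\<alpha> + \<mu>) x" (is "_ \<le> ?p + ?q")
proof (rule power2_le_imp_le)
  have pos: "0 \<le> Ki \<beta> x" for \<beta>
    using Ki_pos[OF assms] less_imp_le by blast
  have "(Ki \<alpha> x)\<^sup>2 * (Ki \<alpha> x)\<^sup>2 \<le> (Ki (\<alpha> + \<nu>) x * Ki (\<alpha> - \<nu>) x) * (Ki (\<alpha> + \<mu>) x * Ki (\<alpha> - \<mu>) x)"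
    using pos by (intro mult_mono Ki_turan_symmetric assms mult_nonneg_nonneg) auto
  then have "(2 * (Ki \<alpha> x)\<^sup>2)\<^sup>2 \<le> 4 * (?p * ?q)"
    by (simp add: power2_eq_square algebra_simps)
  also have "\<dots> \<le> (?p + ?q)\<^sup>2"
    using zero_le_power2[of "?p - ?q"] by (simp add: power2_eq_square algebra_simps)
  finally show "(2 * (Ki \<alpha> x)\<^sup>2)\<^sup>2 \<le> (?p + ?q)\<^sup>2" .
  show "0 \<le> ?p + ?q"
    using pos by simp
qed

section \<open>Exponential convexity\<close>

text \<open>The quadratic form is the integral of the weight times the square of a linear
  combination of the \<open>e j\<close>.\<close>

lemma positive_definite_integral:
  fixes \<xi> :: "nat \<Rightarrow> real" and e :: "nat \<Rightarrow> 'a \<Rightarrow> real"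
  assumes int: "\<And>j k. j \<in> A \<Longrightarrow> k \<in> A \<Longrightarrow> integrable M (\<lambda>t. w t * (e j t * e k t))"
    and w: "\<And>t. 0 \<le> w t"
  shows "0 \<le> (\<Sum>j\<in>A. \<Sum>k\<in>A. \<xi> j * \<xi> k * (LINT t|M. w t * (e j t * e k t)))"
proof -
  have "(\<Sum>j\<in>A. \<Sum>k\<in>A. \<xi> j * \<xi> k * (LINT t|M. w t * (e j t * e k t)))
      = (LINT t|M. (\<Sum>j\<in>A. \<Sum>k\<in>A. \<xi> j * \<xi> k * (w t * (e j t * e k t))))"
    using int by (simp add: Bochner_Integration.integral_sum Bochner_Integration.integrable_sum)
  also have "\<dots> = (LINT t|M. w t * (\<Sum>j\<in>A. \<xi> j * e j t)\<^sup>2)"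
    by (simp add: power2_eq_square sum_product sum_distrib_left mult_ac)
  also have "\<dots> \<ge> 0"
    using w by (intro Bochner_Integration.integral_nonneg mult_nonneg_nonneg) auto
  finally show ?thesis .
qed

lemma exponentially_convex_on_Ki_argument: "exponentially_convex_on {0<..} (\<lambda>x. Ki \<alpha> x)"
  unfolding exponentially_convex_on_def
proof (intro conjI allI impI)
  show "continuous_on {0<..} (Ki \<alpha>)"
    by (rule continuous_on_Ki)
  fix n :: nat and \<xi> x :: "nat \<Rightarrow> real"
  assume pos: "\<forall>j\<in>{1..n}. \<forall>k\<in>{1..n}. x j + x k \<in> {0<..}"
  \<comment> \<open>The exponential splits over the sum of arguments, and the power of cosh t is the
    weight.\<close>
  have k: "kernel 0 \<alpha> (x j + x k)
      = (\<lambda>t. cosh t powr (- \<alpha>) * (exp (- x j * cosh t) * exp (- x k * cosh t)))" for j k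
    by (simp add: fun_eq_iff kernel_0_powr exp_add[symmetric] algebra_simps)
  show "0 \<le> (\<Sum>j = 1..n. \<Sum>k = 1..n. \<xi> j * \<xi> k * Ki \<alpha> (x j + x k))"
    unfolding Ki_eq_KI KI_def k
    using pos by (intro positive_definite_integral) (auto simp only: k[symmetric] greaterThan_iff powr_ge_zero intro!: integrable_kernel)
qed

lemma exponentially_convex_on_Ki_order:
  assumes "x > 0"
  shows "exponentially_convex_on UNIV (\<lambda>\<alpha>. Ki \<alpha> x)"
  unfolding exponentially_convex_on_def
proof (intro conjI allI impI)
  show "continuous_on UNIV (\<lambda>\<alpha>. Ki \<alpha> x)"
    using KI_has_real_derivative_order[OF assms] unfolding Ki_eq_KI
    by (intro continuous_at_imp_continuous_on ballI DERIV_isCont)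
  fix n :: nat and \<xi> a :: "nat \<Rightarrow> real"
  \<comment> \<open>Here the power of cosh t splits over the sum of orders, and the exponential is
    the weight.\<close>
  have k: "kernel 0 (a j + a k) x
      = (\<lambda>t. exp (- x * cosh t) * (cosh t powr (- a j) * cosh t powr (- a k)))" for j k
    by (simp add: fun_eq_iff kernel_0_powr flip: powr_add)
  show "0 \<le> (\<Sum>j = 1..n. \<Sum>k = 1..n. \<xi> j * \<xi> k * Ki (a j + a k) x)"
    unfolding Ki_eq_KI KI_def k
    using assms by (intro positive_definite_integral) (auto simp only: k[symmetric] exp_ge_zero intro!: integrable_kernel)
qed

section \<open>Joint midpoint inequality and the final forms of the remaining bounds\<close>

lemma Ki_joint_midpoint:
  assumes "\<nu> \<in> {-1<..<1}" "x > 0"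
  shows "(Ki \<alpha> x)\<^sup>2 \<le> Ki (\<alpha> * (1 + \<mu>)) ((1 + \<nu>) * x) * Ki (\<alpha> * (1 - \<mu>)) ((1 - \<nu>) * x)"
proof -
  \<comment> \<open>The two points are symmetric about (\<alpha>, x), and |\<nu>| < 1 keeps both
    arguments positive.\<close>
  let ?u = "(\<alpha> * (1 + \<mu>), (1 + \<nu>) * x)" and ?v = "(\<alpha> * (1 - \<mu>), (1 - \<nu>) * x)"
  have "?u \<in> UNIV \<times> {0<..}" "?v \<in> UNIV \<times> {0<..}"
    using assms by auto
  note log_convex_on_midpoint[OF log_convex_on_Ki_joint this]
  moreover have "(1/2) *\<^sub>R ?u + (1/2) *\<^sub>R ?v = (\<alpha>, x)"
    by (simp add: field_simps)
  ultimately show ?thesis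
    by simp
qed

text \<open>The Gamma factor is the reciprocal of \<open>Ki \<alpha> 0\<close>.\<close>

lemma Ki_supermultiplicative_Gamma:
  assumes "\<alpha> > 0" "x > 0" "y > 0"
  shows "2 * Gamma ((\<alpha> + 1) / 2) / (sqrt pi * Gamma (\<alpha> / 2)) * Ki \<alpha> x * Ki \<alpha> y \<le> Ki \<alpha> (x + y)"
proof -
  have "2 * Gamma ((\<alpha> + 1) / 2) / (sqrt pi * Gamma (\<alpha> / 2)) * Ki \<alpha> x * Ki \<alpha> y
      = Ki \<alpha> x * Ki \<alpha> y / Ki \<alpha> 0"
    by (simp add: Ki_0_eq_Gamma[OF assms(1)])
  also have "\<dots> \<le> Ki \<alpha> (x + y)"
    using Ki_supermultiplicative[OF assms] Ki_0_pos[OF assms(1)]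
    by (simp add: pos_divide_le_eq mult.commute)
  finally show ?thesis .
qed

lemma Ki_subadditive:
  assumes "x > 0" "y > 0"
  shows "Ki \<alpha> (x + y) \<le> Ki \<alpha> x + Ki \<alpha> y"
  using Ki_antimono_argument[of x "x + y" \<alpha>] Ki_pos[OF assms(2), of \<alpha>] assms by simp

lemma Ki_order_subadditive:
  assumes "\<alpha> > 0" "\<beta> > 0" "x > 0"
  shows "Ki (\<alpha> + \<beta>) x \<le> Ki \<alpha> x + Ki \<beta> x"
  using Ki_antimono_order[OF assms(3), of \<alpha> "\<alpha> + \<beta>"] Ki_pos[OF assms(3), of \<beta>] assms by simp

lemma Ki_ratio_ge:
  assumes "\<alpha> \<ge> 2" "x > 0"
  shows "- (Ki (\<alpha> - 2) x / Ki (\<alpha> - 1) x) \<ge> - (Ki 0 x / Ki 1 x)"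
  using Ki_ratio_le[OF assms] Ki_pos[OF assms(2), of "\<alpha> - 1"] Ki_pos[OF assms(2), of 1]
  by (simp add: divide_simps mult.commute)

theorem theorem1:
  shows
    \<comment> \<open>(a)\<close>
    "(\<forall>\<alpha>. completely_monotonic_on {0<..} (\<lambda>x. Ki \<alpha> x)) \<and>
    \<comment> \<open>(b)\<close>
     (\<forall>x>0. completely_monotonic_on UNIV (\<lambda>\<alpha>. Ki \<alpha> x)) \<and>
    \<comment> \<open>(c)\<close>
     (\<forall>x>0. log_convex_on UNIV (\<lambda>\<alpha>. Ki \<alpha> x)) \<and>
    \<comment> \<open>(d)\<close>
     (\<forall>\<alpha>. log_convex_on {0<..} (\<lambda>x. Ki \<alpha> x)) \<and>
    \<comment> \<open>(e)\<close>
     (\<forall>\<alpha>\<in>\<int>. \<alpha> \<ge> -1 \<longrightarrow> geometrically_concave (\<lambda>x. Ki \<alpha> x)) \<and>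
     (\<forall>\<alpha>\<in>\<int>. \<alpha> \<ge> -1 \<longrightarrow> (\<forall>x>0. \<forall>y>0.
        Ki \<alpha> (sqrt (x * y)) \<ge> sqrt (Ki \<alpha> x * Ki \<alpha> y) \<and>
        sqrt (Ki \<alpha> x * Ki \<alpha> y) \<ge> Ki \<alpha> ((x + y) / 2) \<and>
        1 \<le> Ki \<alpha> x * Ki (\<alpha> - 2) x / (Ki (\<alpha> - 1) x)\<^sup>2 \<and>
        Ki \<alpha> x * Ki (\<alpha> - 2) x / (Ki (\<alpha> - 1) x)\<^sup>2 \<le> 1 + Ki \<alpha> x / (x * Ki (\<alpha> - 1) x))) \<and>
     (\<forall>\<alpha>. \<forall>x>0. \<forall>y>0.
        sqrt (Ki \<alpha> x * Ki \<alpha> y) \<ge> Ki \<alpha> ((x + y) / 2) \<and>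
        1 \<le> Ki \<alpha> x * Ki (\<alpha> - 2) x / (Ki (\<alpha> - 1) x)\<^sup>2) \<and>
    \<comment> \<open>(f)\<close>
     (\<forall>\<alpha> \<beta>. \<forall>x>0. (\<alpha> + \<beta> \<le> 0 \<and> 0 \<le> \<beta>) \<or> (\<alpha> + \<beta> \<ge> 0 \<and> 0 \<ge> \<beta>) \<longrightarrow>
        Ki (- \<beta>) x * Ki (\<alpha> + \<beta>) x \<le> Ki 0 x * Ki \<alpha> x) \<and>
     (\<forall>\<alpha> \<beta>. \<forall>x>0. (\<beta> \<ge> 0 \<and> \<alpha> + \<beta> \<ge> 0) \<or> (\<beta> \<le> 0 \<and> \<alpha> + \<beta> \<le> 0) \<longrightarrow>
        Ki (- \<beta>) x * Ki (\<alpha> + \<beta>) x \<ge> Ki 0 x * Ki \<alpha> x) \<and>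
     (\<forall>\<alpha>\<ge>2. \<forall>x>0.
        deriv (deriv (Ki \<alpha>)) x / deriv (Ki \<alpha>) x = - (Ki (\<alpha> - 2) x / Ki (\<alpha> - 1) x) \<and>
        - (Ki (\<alpha> - 2) x / Ki (\<alpha> - 1) x) \<ge> - (Ki 0 x / Ki 1 x) \<and>
        - (Ki 0 x / Ki 1 x) = deriv (deriv (Ki 2)) x / deriv (Ki 2) x) \<and>
     (\<forall>\<alpha>\<ge>2. convex_on_wrt {0<..} (\<lambda>x. - Ki \<alpha> x) (\<lambda>x. - Ki 2 x)) \<and>
    \<comment> \<open>(g)\<close>
     (\<forall>\<alpha> \<beta>. \<forall>x>0. \<alpha> + \<beta> \<ge> 0 \<and> \<beta> \<le> 0 \<longrightarrow>
        \<bar>Ki 0 x * Ki \<alpha> x - Ki (- \<beta>) x * Ki (\<alpha> + \<beta>) x\<bar> \<le> (Ki 0 x)\<^sup>2 / 4) \<and>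
    \<comment> \<open>(h)\<close>
     (\<forall>\<alpha>>0. \<forall>x>0. \<forall>y>0.
        2 * Gamma ((\<alpha> + 1) / 2) / (sqrt pi * Gamma (\<alpha> / 2)) * Ki \<alpha> x * Ki \<alpha> y \<le> Ki \<alpha> (x + y) \<and>
        Ki \<alpha> (x + y) \<le> Ki \<alpha> x + Ki \<alpha> y \<and>
        Ki \<alpha> x + Ki \<alpha> y
          \<le> Ki \<alpha> (x + y) + sqrt pi * Gamma (\<alpha> / 2) / (2 * Gamma ((\<alpha> + 1) / 2))) \<and>
     (\<forall>r\<ge>1. \<forall>s\<ge>1. \<forall>\<alpha>>0. \<forall>x>0. \<forall>y>0.
        r * Ki \<alpha> x + s * Ki \<alpha> y
          \<le> Ki \<alpha> (r * x + s * y)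
             + (r + s - 1) * (sqrt pi * Gamma (\<alpha> / 2) / (2 * Gamma ((\<alpha> + 1) / 2)))) \<and>
    \<comment> \<open>(i)\<close>
     (\<forall>\<alpha>>0. \<forall>\<beta>>0. \<forall>x>0.
        1 / Ki 0 x * Ki \<alpha> x * Ki \<beta> x \<le> Ki (\<alpha> + \<beta>) x \<and>
        Ki (\<alpha> + \<beta>) x \<le> Ki \<alpha> x + Ki \<beta> x \<and>
        Ki \<alpha> x + Ki \<beta> x \<le> Ki 0 x + Ki (\<alpha> + \<beta>) x) \<and>
    \<comment> \<open>(j)\<close>
     (\<forall>\<alpha>>0. exponentially_convex_on {0<..} (\<lambda>x. Ki \<alpha> x)) \<and>
    \<comment> \<open>(k)\<close>
     (\<forall>x>0. exponentially_convex_on UNIV (\<lambda>\<alpha>. Ki \<alpha> x)) \<and>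
    \<comment> \<open>(l)\<close>
     (\<forall>\<alpha> \<beta>. \<forall>x>0. Ki (\<alpha> + \<beta>) x + Ki (\<alpha> - \<beta>) x \<ge> 2 * Ki \<alpha> x) \<and>
    \<comment> \<open>(m)\<close>
     (\<forall>\<alpha> \<nu> \<mu>. \<forall>x>0.
        Ki (\<alpha> + \<nu>) x * Ki (\<alpha> - \<mu>) x + Ki (\<alpha> - \<nu>) x * Ki (\<alpha> + \<mu>) x \<ge> 2 * (Ki \<alpha> x)\<^sup>2) \<and>
    \<comment> \<open>(n)\<close>
     log_convex_on (UNIV \<times> {0<..}) (\<lambda>(\<alpha>, x). Ki \<alpha> x) \<and>
     (\<forall>\<alpha> \<mu>. \<forall>\<nu>\<in>{-1<..<1}. \<forall>x>0.
        (Ki \<alpha> x)\<^sup>2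
          \<le> Ki (\<alpha> * (1 + \<mu>)) ((1 + \<nu>) * x) * Ki (\<alpha> * (1 - \<mu>)) ((1 - \<nu>) * x))"
proof (intro conjI allI impI ballI)
  fix \<alpha> x y :: real
  assume \<alpha>: "\<alpha> > 0" and x: "x > 0" and y: "y > 0"
  show "Ki \<alpha> x + Ki \<alpha> y
      \<le> Ki \<alpha> (x + y) + sqrt pi * Gamma (\<alpha> / 2) / (2 * Gamma ((\<alpha> + 1) / 2))"
    \<comment> \<open>With r = s = 1 the coefficient r + s - 1 of the value at 0 is 1.\<close>
    using Ki_weighted_sum_le[of 1 1 \<alpha> x y] \<alpha> x y by (simp add: Ki_0_eq_Gamma)
  fix r s :: real
  assume "r \<ge> 1" "s \<ge> 1"
  then show "r * Ki \<alpha> x + s * Ki \<alpha> y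
      \<le> Ki \<alpha> (r * x + s * y) + (r + s - 1) * (sqrt pi * Gamma (\<alpha> / 2) / (2 * Gamma ((\<alpha> + 1) / 2)))"
    using Ki_weighted_sum_le[of r s \<alpha> x y] \<alpha> x y by (simp add: Ki_0_eq_Gamma)
next
  fix x :: real
  assume "x > 0"
  then show "- (Ki 0 x / Ki 1 x) = deriv (deriv (Ki 2)) x / deriv (Ki 2) x"
    by (simp add: deriv_ratio_Ki)
qed ((rule completely_monotonic_on_Ki_argument completely_monotonic_on_Ki_order
      log_convex_on_Ki_order log_convex_on_Ki_argument geometrically_concave_Ki
      Ki_geometric_mean_ge Ki_arithmetic_mean_le Ki_turan_lower Ki_turan_upper
      Ki_product_le Ki_product_ge deriv_ratio_Ki Ki_ratio_ge convex_on_wrt_Ki Ki_gruess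
      Ki_supermultiplicative_Gamma Ki_subadditive Ki_order_supermultiplicative
      Ki_order_subadditive Ki_order_sum_le exponentially_convex_on_Ki_argument
      exponentially_convex_on_Ki_order Ki_order_midpoint Ki_order_double_midpoint
      log_convex_on_Ki_joint Ki_joint_midpoint; (assumption | erule conjunct1 conjunct2)?)+)

end
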